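(* Consider, for $x\ge0$, the planar piecewise-smooth (Filippov) system $$\dot x=1,\qquad \dot y=-ay-\big[1+(1+\lambda)\cos\pi x\big]\sin\tfrac{\pi x}{2},$$ with $\lambda=\operatorname{sign}(y)$ for $y\ne0$ and $\lambda\in(-1,1)$ on $y=0$. There exists $a_l>0$, $a_l\ll1$, such that for all $a\in(0,a_l)$ this system has a non-sliding periodic solution, which is $4$-periodic (i.e. $y(x+4)=y(x)$) and locally asymptotically stable.
   Context: For $y>0$ the system is $\dot y=-ay-\sin(3\pi x/2)$ and for $y<0$ it is $\dot y=-ay-\sin(\pi x/2)$. The sliding manifold is $\Lambda^L=\{(x,0): x\in(\frac23+2n,\frac43+2n),\ n\in\mathbb{N}\}$, the set of points on $y=0$ where there is $\lambda\in(-1,1)$ making $\dot y=0$; solutions may move along $y=0$ (with $y\equiv0$, $\dot x=1$) only on $\Lambda^L$, and elsewhere on $y=0$ they cross transversally (Filippov convention). A periodic solution is sliding if part of it lies on $\Lambda^L$, and non-sliding otherwise. *)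

theory Defs
  imports "HOL-Analysis.Analysis"
begin

definition rhs :: "real \<Rightarrow> real \<Rightarrow> real \<Rightarrow> real \<Rightarrow> real" where
  "rhs a lam x y = - a * y - (1 + (1 + lam) * cos (pi * x)) * sin (pi * x / 2)"

text \<open>Filippov set-valued right-hand side: lam = sign y off y = 0, and the
  (closed convex hull) lam in [-1,1] on y = 0.\<close>
definition filippov_F :: "real \<Rightarrow> real \<Rightarrow> real \<Rightarrow> real set" where
  "filippov_F a x y =
     (if y > 0 then {rhs a 1 x y}
      else if y < 0 then {rhs a (-1) x y}
      else {rhs a lam x 0 | lam. -1 \<le> lam \<and> lam \<le> 1})"

text \<open>Filippov solution on x \<ge> 0 (x plays the role of time since xdot = 1):
  y is absolutely continuous (an indefinite integral of a locally integrable h)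
  and y'(x) = h(x) \<in> F(x, y(x)) for almost every x \<ge> 0.\<close>
definition filippov_sol :: "real \<Rightarrow> (real \<Rightarrow> real) \<Rightarrow> bool" where
  "filippov_sol a y \<longleftrightarrow>
     (\<exists>h. (\<forall>t\<ge>0. (h has_integral (y t - y 0)) {0..t}) \<and>
          (AE x in lborel. x \<ge> 0 \<longrightarrow> h x \<in> filippov_F a x (y x)))"

definition sliding_set :: "real set" where
  "sliding_set = {x. \<exists>n::nat. 2/3 + 2 * real n < x \<and> x < 4/3 + 2 * real n}"

definition sliding :: "(real \<Rightarrow> real) \<Rightarrow> bool" where
  "sliding y \<longleftrightarrow> (\<exists>c d. 0 \<le> c \<and> c < d \<and> (\<forall>x\<in>{c<..<d}. y x = 0 \<and> x \<in> sliding_set))"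

definition periodic4 :: "(real \<Rightarrow> real) \<Rightarrow> bool" where
  "periodic4 y \<longleftrightarrow> (\<forall>x\<ge>0. y (x + 4) = y x)"

definition loc_asym_stable :: "real \<Rightarrow> (real \<Rightarrow> real) \<Rightarrow> bool" where
  "loc_asym_stable a y \<longleftrightarrow>
     (\<forall>\<epsilon>>0. \<exists>\<delta>>0. \<forall>z. filippov_sol a z \<and> \<bar>z 0 - y 0\<bar> < \<delta> \<longrightarrow>
         (\<forall>x\<ge>0. \<bar>z x - y x\<bar> < \<epsilon>)) \<and>
     (\<exists>\<delta>>0. \<forall>z. filippov_sol a z \<and> \<bar>z 0 - y 0\<bar> < \<delta> \<longrightarrow>
         ((\<lambda>x. z x - y x) \<longlongrightarrow> 0) at_top)"

end

theory Submission
  imports Defs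
begin

text \<open>
  For \<open>a = 0\<close> every orbit that crosses the axis downwards at \<open>p < 2/3\<close> and upwards at \<open>q = 4 - p\<close>
  is periodic. For \<open>a > 0\<close> damping makes the lower arc return early, \<open>q < 4 - p\<close>, and this alone
  makes the return map a contraction wherever it is defined. A fixed point is found by moving \<open>p\<close>
  from \<open>0\<close>, where the orbit gains height over one period, to the value for which \<open>q = 10/3\<close>, close
  to the tangency at \<open>2/3\<close>, where it loses height.

  The primitives \<open>prim a w\<close> of \<open>e\<^sup>a\<^sup>x sin (w x)\<close> linearise the flow: \<open>e\<^sup>a\<^sup>x y + prim a w x\<close> is constant
  along each smooth arc, with \<open>w = 3\<pi>/2\<close> above and \<open>w = \<pi>/2\<close> below the axis. Near the crossings
  both one-sided fields have the same sign, which forces Filippov solutions to leave the axis and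
  gives their uniqueness despite the non-unique (repelling) sliding region on \<open>(2/3, 4/3)\<close>.
\<close>

subsection \<open>The return map\<close>

definition prim :: "real \<Rightarrow> real \<Rightarrow> real \<Rightarrow> real" where
  "prim a w x = exp (a * x) * (a * sin (w * x) - w * cos (w * x)) / (a\<^sup>2 + w\<^sup>2)"

abbreviation Hp :: "real \<Rightarrow> real \<Rightarrow> real" where "Hp a \<equiv> prim a (3 * pi / 2)"
abbreviation Hm :: "real \<Rightarrow> real \<Rightarrow> real" where "Hm a \<equiv> prim a (pi / 2)"

lemma prim_has_derivative:
  assumes "w > 0"
  shows "(prim a w has_real_derivative exp (a * x) * sin (w * x)) (at x within S)"
proof -
  have "((\<lambda>x. exp (a * x) * (a * sin (w * x) - w * cos (w * x))) has_real_derivative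
      exp (a * x) * sin (w * x) * (a\<^sup>2 + w\<^sup>2)) (at x within S)"
    by (auto intro!: derivative_eq_intros simp: algebra_simps power2_eq_square)
  from DERIV_cdivide[OF this, of "a\<^sup>2 + w\<^sup>2"] show ?thesis
    using assms unfolding prim_def[abs_def] by simp
qed

lemma Hp_deriv: "(Hp a has_real_derivative exp (a * x) * sin (3 * pi * x / 2)) (at x within S)"
  using prim_has_derivative[of "3 * pi / 2" a x S] by (simp add: mult.commute)

lemma Hm_deriv: "(Hm a has_real_derivative exp (a * x) * sin (pi * x / 2)) (at x within S)"
  using prim_has_derivative[of "pi / 2" a x S] by simp

lemma continuous_prim: "w > 0 \<Longrightarrow> continuous_on S (prim a w)"
  by (rule DERIV_continuous_on, rule prim_has_derivative)

lemma Hp_cont: "continuous_on S (Hp a)" and Hm_cont: "continuous_on S (Hm a)"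
  by (auto intro!: continuous_prim)

text \<open>The triple-angle formula, which identifies the forcing above the axis with
  \<open>rhs\<close> at \<open>lam = 1\<close>; the factor \<open>1 + 2 * cos (pi * x)\<close> is
  the ratio of the upper forcing to the lower one.\<close>

lemma sin_three: "sin (3 * pi * x / 2) = (1 + 2 * cos (pi * x)) * sin (pi * x / 2)"
proof -
  have c: "cos (pi * x) = 1 - 2 * (sin (pi * x / 2))\<^sup>2"
    using cos_double_sin[of "pi * x / 2"] by simp
  have "sin (3 * pi * x / 2) = 3 * sin (pi * x / 2) - 4 * sin (pi * x / 2) ^ 3"
  proof -
    have e: "3 * pi * x / 2 = pi * x / 2 + 2 * (pi * x / 2)" by (simp add: field_simps)
    have "sin (3 * pi * x / 2) = sin (pi*x/2) * cos (pi * x) + cos (pi*x/2) * sin (2 * (pi * x/2))"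
      unfolding e sin_add by simp
    also have "\<dots> = sin (pi*x/2) * cos (pi * x) + 2 * sin (pi*x/2) * (1 - (sin (pi*x/2))\<^sup>2)"
      by (simp only: sin_double cos_squared_eq[symmetric]) (simp add: power2_eq_square)
    also have "\<dots> = 3 * sin (pi * x / 2) - 4 * sin (pi * x / 2) ^ 3"
      unfolding c by (simp add: algebra_simps power2_eq_square power3_eq_cube)
    finally show ?thesis .
  qed
  then show ?thesis unfolding c by (simp add: algebra_simps power2_eq_square power3_eq_cube)
qed

text \<open>Freezing the forcing ratio at \<open>p\<close> reduces a comparison of increments of
  \<open>Hp\<close> and \<open>Hm\<close> to the signs of the sine and of
  \<open>cos (pi * x) - cos (pi * p)\<close>.\<close>

lemma Hp_minus_Hm_deriv:
  "((\<lambda>x. Hp a x - (1 + 2 * cos (pi * p)) * Hm a x) has_real_derivative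
      exp (a * x) * sin (pi * x / 2) * (2 * cos (pi * x) - 2 * cos (pi * p))) (at x)"
proof -
  have "((\<lambda>x. Hp a x - (1 + 2 * cos (pi * p)) * Hm a x) has_real_derivative
      exp (a * x) * sin (3 * pi * x / 2) - (1 + 2 * cos (pi * p)) * (exp (a * x) * sin (pi * x / 2))) (at x)"
    by (intro DERIV_diff Hp_deriv DERIV_cmult Hm_deriv)
  then show ?thesis unfolding sin_three by (simp add: algebra_simps)
qed

section \<open>Signs of the forcing terms and monotonicity of the primitives\<close>

lemma sin_half_pos: "0 < x \<Longrightarrow> x < 2 \<Longrightarrow> sin (pi * x / 2) > 0"
  by (rule sin_gt_zero) (auto simp: field_simps)

lemma sin_half_neg: "2 < x \<Longrightarrow> x < 4 \<Longrightarrow> sin (pi * x / 2) < 0"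
proof -
  assume x: "2 < x" "x < 4"
  have "sin (pi * (4 - x) / 2) = sin (2 * pi - pi * x / 2)"
      by (rule arg_cong[of _ _ sin]) (simp add: field_simps)
  also have "\<dots> = - sin (pi * x / 2)" by (simp add: sin_diff)
  finally show ?thesis using sin_half_pos[of "4 - x"] x by simp
qed

lemma sin_three_half_pos: "0 < x \<Longrightarrow> x < 2/3 \<Longrightarrow> sin (3 * pi * x / 2) > 0"
  by (rule sin_gt_zero) (auto simp: field_simps)

lemma sin_three_half_neg: "10/3 < x \<Longrightarrow> x < 4 \<Longrightarrow> sin (3 * pi * x / 2) < 0"
proof -
  assume x: "10/3 < x" "x < 4"
  have "sin (3 * pi * (4 - x) / 2) = sin (2 * pi * of_int 3 - 3 * pi * x / 2)"
    by (rule arg_cong[of _ _ sin]) (simp add: field_simps)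
  also have "\<dots> = - sin (3 * pi * x / 2)"
    unfolding sin_diff by (simp only: sin_int_2pin cos_int_2pin mult_zero_left mult_1 diff_0)
  finally show ?thesis using sin_three_half_pos[of "4 - x"] x by simp
qed

lemma strict_mono_prim:
  assumes "w > 0" "x < y" "\<And>s. x < s \<Longrightarrow> s < y \<Longrightarrow> sin (w * s) > 0"
  shows "prim a w x < prim a w y"
  using assms
  by (intro DERIV_pos_imp_increasing_open[OF \<open>x < y\<close>, where f = "prim a w"])
     (auto intro!: prim_has_derivative continuous_prim mult_pos_pos)

lemma strict_antimono_prim:
  assumes "w > 0" "x < y" "\<And>s. x < s \<Longrightarrow> s < y \<Longrightarrow> sin (w * s) < 0"
  shows "prim a w y < prim a w x"
  using assms
  by (intro DERIV_neg_imp_decreasing_open[OF \<open>x < y\<close>, where f = "prim a w"])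
     (auto intro!: prim_has_derivative continuous_prim mult_pos_neg)

lemma Hp_less: "0 \<le> x \<Longrightarrow> x < y \<Longrightarrow> y \<le> 2/3 \<Longrightarrow> Hp a x < Hp a y"
  using sin_three_half_pos by (intro strict_mono_prim) (auto simp: mult.commute)

lemma Hm_less: "0 \<le> x \<Longrightarrow> x < y \<Longrightarrow> y \<le> 2 \<Longrightarrow> Hm a x < Hm a y"
  using sin_half_pos by (intro strict_mono_prim) (auto simp: mult.commute)

lemma Hm_greater: "2 \<le> x \<Longrightarrow> x < y \<Longrightarrow> y \<le> 4 \<Longrightarrow> Hm a y < Hm a x"
  using sin_half_neg by (intro strict_antimono_prim) (auto simp: mult.commute)

lemma Hp_greater: "10/3 \<le> x \<Longrightarrow> x < y \<Longrightarrow> y \<le> 4 \<Longrightarrow> Hp a y < Hp a x"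
  using sin_three_half_neg by (intro strict_antimono_prim) (auto simp: mult.commute)

text \<open>The difference \<open>Hm a x - Hm a (4 - x)\<close> vanishes at \<open>x = 2\<close> and
  decreases before it: reflected forcing values are opposite, and the weight
  \<open>exp (a * x)\<close> is larger at the reflected point. Here damping breaks the symmetry of
  \<open>a = 0\<close>.\<close>

lemma Hm_reflect_less:
  assumes "a > 0" "0 \<le> p" "p < 2"
  shows "Hm a (4 - p) < Hm a p"
proof -
  have "Hm a 2 - Hm a (4 - 2) < Hm a p - Hm a (4 - p)"
  proof (rule DERIV_neg_imp_decreasing_open[OF \<open>p < 2\<close>])
    fix x assume x: "p < x" "x < 2"
    have e: "sin (pi * (4 - x) / 2) = - sin (pi * x / 2)"
    proof -
      have "sin (pi * (4 - x) / 2) = sin (2 * pi - pi * x / 2)"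
      by (rule arg_cong[of _ _ sin]) (simp add: field_simps)
      then show ?thesis by (simp add: sin_diff)
    qed
    have d: "((\<lambda>x. Hm a x - Hm a (4 - x)) has_real_derivative
        exp (a * x) * sin (pi * x / 2) - (exp (a * (4 - x)) * sin (pi * (4 - x) / 2)) * (0 - 1)) (at x)"
      by (intro DERIV_diff Hm_deriv DERIV_chain'[OF _ Hm_deriv] DERIV_const DERIV_ident)
    have "exp (a * x) < exp (a * (4 - x))" using x assms by simp
    moreover have "sin (pi * x / 2) > 0" using x assms by (intro sin_half_pos) auto
    ultimately have "(exp (a * x) - exp (a * (4 - x))) * sin (pi * x / 2) < 0"
      by (intro mult_neg_pos) auto
    with d e show "\<exists>y. ((\<lambda>x. Hm a x - Hm a (4 - x)) has_real_derivative y) (at x) \<and> y < 0"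
      by (intro exI[of _ "exp (a * x) * sin (pi * x / 2) - (exp (a * (4 - x)) * sin (pi * (4 - x) / 2)) * (0 - 1)"])
         (auto simp: algebra_simps)
  next
    show "continuous_on {p..2} (\<lambda>x. Hm a x - Hm a (4 - x))"
      by (intro continuous_intros continuous_on_compose2[OF Hm_cont[of UNIV]]) auto
  qed
  then show ?thesis by simp
qed

text \<open>Since \<open>exp (a * x) * y + Hm a x\<close> is constant below the axis, the equation
  says that the arc leaving the axis at \<open>p\<close> meets it again at \<open>q\<close>. On each
  of the two ranges both one-sided fields on the axis point the same way.\<close>

definition crossing :: "real \<Rightarrow> real \<Rightarrow> real \<Rightarrow> bool" where
  "crossing a p q \<longleftrightarrow> 0 < p \<and> p < 2/3 \<and> 10/3 < q \<and> q < 4 \<and> Hm a p = Hm a q"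

text \<open>Otherwise monotonicity of \<open>Hm\<close> on \<open>[2, 4]\<close> would give
  \<open>Hm a q \<le> Hm a (4 - p) < Hm a p\<close>.\<close>

lemma return_early:
  assumes "a > 0" "0 \<le> p" "p < 2" "2 \<le> q" "q \<le> 4" "Hm a p = Hm a q"
  shows "q < 4 - p"
proof (rule ccontr)
  assume "\<not> q < 4 - p"
  then have "Hm a q \<le> Hm a (4 - p)"
    using Hm_greater[of "4 - p" q a] assms by (cases "q = 4 - p") auto
  with Hm_reflect_less[of a p] assms show False by simp
qed

text \<open>\<open>Hm\<close> rises up to 2 and falls afterwards, with equal values at both ends;
  hence the arc stays strictly below the axis in between.\<close>

lemma Hm_excursion:
  assumes "crossing a p q" "p < x" "x < q"
  shows "Hm a p < Hm a x"
  using Hm_less[of p x a] Hm_greater[of x q a] assms unfolding crossing_def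
  by (cases "x \<le> 2") auto

text \<open>The linearised return map has multiplier
  \<open>e\<^sup>-\<^sup>4\<^sup>a (1 + 2 cos \<pi>q) / (1 + 2 cos \<pi>p)\<close>, since \<open>sin (3\<pi>x/2) / sin (\<pi>x/2) = 1 + 2 cos \<pi>x\<close>;
  the quotient is below 1 because the orbit returns to the axis before \<open>4 - p\<close>.\<close>
lemma return_map_nonexpanding:
  assumes "crossing a p q" "crossing a p' q'" "p \<le> p'" "p' \<le> 4 - q"
  shows "0 \<le> Hp a q' - Hp a q" "Hp a q' - Hp a q \<le> Hp a p' - Hp a p"
proof -
  \<comment> \<open>One slope serves both intervals: the forcing ratio at \<open>p'\<close> is its
    minimum on \<open>[p, p']\<close> and, as \<open>p' \<le> 4 - q\<close>, an upper bound on
    \<open>[q', q]\<close>. There the sine is negative, so \<open>Hp a - r * Hm a\<close> is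
    nondecreasing on both.\<close>
  define r where "r = 1 + 2 * cos (pi * p')"
  have rng: "0 < p" "p < 2/3" "10/3 < q" "q < 4" "Hm a p = Hm a q"
     "0 < p'" "p' < 2/3" "10/3 < q'" "q' < 4" "Hm a p' = Hm a q'"
    using assms unfolding crossing_def by auto
  have "Hm a p \<le> Hm a p'" using Hm_less[of p p' a] rng assms by (cases "p = p'") auto
  then have qq: "q' \<le> q" using Hm_greater[of q q' a] rng by (auto simp: not_less[symmetric])
  show "0 \<le> Hp a q' - Hp a q" using Hp_greater[of q' q a] rng qq by (cases "q' = q") auto
  have "Hp a p - r * Hm a p \<le> Hp a p' - r * Hm a p'"
  proof (rule DERIV_nonneg_imp_nondecreasing[OF \<open>p \<le> p'\<close>], intro exI conjI, unfold r_def, rule Hp_minus_Hm_deriv)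
    fix x assume x: "p \<le> x" "x \<le> p'"
    have "cos (pi * p') \<le> cos (pi * x)"
      using x rng by (intro cos_monotone_0_pi_le) (auto simp: field_simps)
    moreover have "sin (pi * x / 2) > 0" using x rng by (intro sin_half_pos) auto
    ultimately show "0 \<le> exp (a * x) * sin (pi * x / 2) * (2 * cos (pi * x) - 2 * cos (pi * p'))"
      by simp
  qed
  moreover have "Hp a q' - r * Hm a q' \<le> Hp a q - r * Hm a q"
  proof (rule DERIV_nonneg_imp_nondecreasing[OF qq], intro exI conjI, unfold r_def, rule Hp_minus_Hm_deriv)
    fix x assume x: "q' \<le> x" "x \<le> q"
    have "cos (pi * (4 - x)) \<le> cos (pi * p')"
    proof (rule cos_monotone_0_pi_le)
      show "pi * p' \<le> pi * (4 - x)" using x assms by (intro mult_left_mono) auto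
      show "pi * (4 - x) \<le> pi" using x rng by simp
    qed (use rng in simp)
    moreover have "cos (pi * (4 - x)) = cos (2 * pi * of_int 2 - pi * x)" by (simp add: algebra_simps)
    then have "cos (pi * (4 - x)) = cos (pi * x)"
      unfolding cos_diff by (simp only: sin_int_2pin cos_int_2pin mult_zero_left mult_1 add_0_right)
    moreover have "sin (pi * x / 2) < 0" using x rng by (intro sin_half_neg) auto
    ultimately show "0 \<le> exp (a * x) * sin (pi * x / 2) * (2 * cos (pi * x) - 2 * cos (pi * p'))"
      by (intro mult_nonpos_nonpos) (auto simp: mult_nonneg_nonpos)
  qed
  ultimately show "Hp a q' - Hp a q \<le> Hp a p' - Hp a p"
    using rng by (simp add: algebra_simps)
qed

subsection \<open>Forward uniqueness at transversal crossings\<close>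

text \<open>Abstract forcings \<open>f\<close> above and \<open>g\<close> below make the class
  invariant under reflection in the axis, so upward crossings reduce to downward ones. On the axis
  the velocity is only confined between the two one-sided values.\<close>

definition two_zone_sol :: "real \<Rightarrow> (real \<Rightarrow> real) \<Rightarrow> (real \<Rightarrow> real) \<Rightarrow> (real \<Rightarrow> real) \<Rightarrow> bool" where
  "two_zone_sol a f g z \<longleftrightarrow>
     (\<exists>h. (\<forall>t\<ge>0. (h has_integral (z t - z 0)) {0..t}) \<and>
       (AE x in lborel. x \<ge> 0 \<longrightarrow>
          (z x > 0 \<longrightarrow> h x = - a * z x - f x) \<and>
          (z x < 0 \<longrightarrow> h x = - a * z x - g x) \<and>
          (z x = 0 \<longrightarrow> - max (f x) (g x) \<le> h x \<and> h x \<le> - min (f x) (g x))))"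

lemma two_zone_sol_uminus:
  assumes "two_zone_sol a f g z"
  shows "two_zone_sol a (\<lambda>x. - g x) (\<lambda>x. - f x) (\<lambda>x. - z x)"
proof -
  obtain h where h: "\<And>t. t \<ge> 0 \<Longrightarrow> (h has_integral (z t - z 0)) {0..t}"
    and ae: "AE x in lborel. x \<ge> 0 \<longrightarrow>
          (z x > 0 \<longrightarrow> h x = - a * z x - f x) \<and>
          (z x < 0 \<longrightarrow> h x = - a * z x - g x) \<and>
          (z x = 0 \<longrightarrow> - max (f x) (g x) \<le> h x \<and> h x \<le> - min (f x) (g x))"
    using assms unfolding two_zone_sol_def by blast
  show ?thesis unfolding two_zone_sol_def
  proof (intro exI[of _ "\<lambda>x. - h x"] conjI allI impI)
    fix t :: real assume "t \<ge> 0"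
    from has_integral_neg[OF h[OF this]]
    show "((\<lambda>x. - h x) has_integral - z t - - z 0) {0..t}" by simp
  next
    show "AE x in lborel. x \<ge> 0 \<longrightarrow>
          (- z x > 0 \<longrightarrow> - h x = - a * - z x - - g x) \<and>
          (- z x < 0 \<longrightarrow> - h x = - a * - z x - - f x) \<and>
          (- z x = 0 \<longrightarrow> - max (- g x) (- f x) \<le> - h x \<and> - h x \<le> - min (- g x) (- f x))"
      using ae by eventually_elim auto
  qed
qed

text \<open>On the axis \<open>rhs a lam x 0\<close> is affine in \<open>lam\<close>, so every
  admissible velocity is a convex combination of the two one-sided ones, with weight
  \<open>\<theta>\<close> on the upper.\<close>

lemma filippov_sol_two_zone:
  assumes "filippov_sol a z"
  shows "two_zone_sol a (\<lambda>x. sin (3 * pi * x / 2)) (\<lambda>x. sin (pi * x / 2)) z"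
proof -
  obtain h where h: "\<And>t. t \<ge> 0 \<Longrightarrow> (h has_integral (z t - z 0)) {0..t}"
    and ae: "AE x in lborel. x \<ge> 0 \<longrightarrow> h x \<in> filippov_F a x (z x)"
    using assms unfolding filippov_sol_def by blast
  have F: "(y > 0 \<longrightarrow> v = - a * y - sin (3 * pi * x / 2)) \<and>
          (y < 0 \<longrightarrow> v = - a * y - sin (pi * x / 2)) \<and>
          (y = 0 \<longrightarrow> - max (sin (3 * pi * x / 2)) (sin (pi * x / 2)) \<le> v \<and>
                     v \<le> - min (sin (3 * pi * x / 2)) (sin (pi * x / 2)))"
    if v_in: "v \<in> filippov_F a x y" for x y v
  proof (cases y "0 :: real" rule: linorder_cases)
    case equal
    define c s where "c = cos (pi * x)" and "s = sin (pi * x / 2)"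
    obtain lam where lam: "- 1 \<le> lam" "lam \<le> 1" "v = - ((1 + (1 + lam) * c) * s)"
      using v_in equal by (auto simp: filippov_F_def rhs_def c_def s_def)
    define \<theta> M m where "\<theta> = (1 + lam) / 2" and "M = max ((1 + 2 * c) * s) s" and "m = min ((1 + 2 * c) * s) s"
    have \<theta>: "0 \<le> \<theta>" "0 \<le> 1 - \<theta>" using lam by (auto simp: \<theta>_def)
    have v: "- v = (1 - \<theta>) * s + \<theta> * ((1 + 2 * c) * s)"
      unfolding lam \<theta>_def by (simp add: field_simps)
    have "(1 - \<theta>) * s \<le> (1 - \<theta>) * M" "\<theta> * ((1 + 2 * c) * s) \<le> \<theta> * M"
      "(1 - \<theta>) * m \<le> (1 - \<theta>) * s" "\<theta> * m \<le> \<theta> * ((1 + 2 * c) * s)"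
      using \<theta> by (auto intro!: mult_left_mono simp: M_def m_def)
    then have "- v \<le> M" "m \<le> - v"
      unfolding v left_diff_distrib by linarith+
    then show ?thesis using equal unfolding sin_three c_def[symmetric] s_def[symmetric] M_def m_def by auto
  next
    case less
    then show ?thesis using v_in by (auto simp: filippov_F_def rhs_def)
  next
    case greater
    then show ?thesis using v_in unfolding sin_three by (auto simp: filippov_F_def rhs_def)
  qed
  show ?thesis unfolding two_zone_sol_def
  proof (intro exI[of _ h] conjI allI impI h)
    show "AE x in lborel. x \<ge> 0 \<longrightarrow>
          (z x > 0 \<longrightarrow> h x = - a * z x - sin (3 * pi * x / 2)) \<and>
          (z x < 0 \<longrightarrow> h x = - a * z x - sin (pi * x / 2)) \<and>
          (z x = 0 \<longrightarrow> - max (sin (3 * pi * x / 2)) (sin (pi * x / 2)) \<le> h x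
                    \<and> h x \<le> - min (sin (3 * pi * x / 2)) (sin (pi * x / 2)))"
      using ae by eventually_elim (use F in blast)
  qed
qed

section \<open>Increments, conservation and transversal departure from the axis\<close>

lemma has_integral_increment:
  fixes h z :: "real \<Rightarrow> real"
  assumes h: "\<And>t. t \<ge> 0 \<Longrightarrow> (h has_integral (z t - z 0)) {0..t}" and "0 \<le> s" "s \<le> t"
  shows "(h has_integral (z t - z s)) {s..t}"
proof -
  have "h integrable_on {s..t}"
    using integrable_on_subinterval[OF has_integral_integrable[OF h[of t]], of s t] assms by auto
  then have i: "(h has_integral integral {s..t} h) {s..t}" by (rule integrable_integral)
  have "(h has_integral (z s - z 0 + integral {s..t} h)) {0..t}"
    by (rule has_integral_combine[OF \<open>0 \<le> s\<close> \<open>s \<le> t\<close> h[OF \<open>0 \<le> s\<close>] i])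
  with h[of t] have "z t - z 0 = z s - z 0 + integral {s..t} h"
    using assms by (intro has_integral_unique) auto
  with i show ?thesis by simp
qed

lemma two_zone_continuous:
  assumes "two_zone_sol a f g z"
  shows "continuous_on {0..} z"
proof -
  obtain h where h: "\<And>t. t \<ge> 0 \<Longrightarrow> (h has_integral (z t - z 0)) {0..t}"
    using assms unfolding two_zone_sol_def by blast
  have c: "continuous_on {0..T} z" if "T \<ge> 0" for T
  proof -
    have "continuous_on {0..T} (\<lambda>x. z 0 + integral {0..x} h)"
      using h[OF that] by (intro continuous_intros indefinite_integral_continuous_1) auto
    moreover have "z 0 + integral {0..x} h = z x" if "x \<in> {0..T}" for x
      using integral_unique[OF h[of x]] that by simp
    ultimately show ?thesis by (rule continuous_on_eq)
  qed
  show ?thesis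
  proof (subst continuous_on_eq_continuous_within, intro ballI)
    fix x :: real assume "x \<in> {0..}"
    then have x: "x \<ge> 0" by simp
    have "continuous (at x within {0..x + 1}) z"
      using c[of "x + 1"] x by (auto simp: continuous_on_eq_continuous_within)
    moreover have "at x within {0..x + 1} = at x within {0..}"
      by (rule at_within_nhd[of x "{..<x + 1}"]) (use x in auto)
    ultimately show "continuous (at x within {0..}) z" by (simp add: continuous_within)
  qed
qed

text \<open>The velocity is known only almost everywhere, so bounds in the separate zones are turned
  into a bound on the increment by integration.\<close>

lemma two_zone_increment_le:
  assumes sol: "two_zone_sol a f g z" and st: "0 \<le> s" "s \<le> t"
    and k: "(k has_integral K) {s..t}"
    and pos: "\<And>x. s < x \<Longrightarrow> x < t \<Longrightarrow> z x > 0 \<Longrightarrow> - a * z x - f x \<le> k x"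
    and neg: "\<And>x. s < x \<Longrightarrow> x < t \<Longrightarrow> z x < 0 \<Longrightarrow> - a * z x - g x \<le> k x"
    and zero: "\<And>x. s < x \<Longrightarrow> x < t \<Longrightarrow> z x = 0 \<Longrightarrow> - min (f x) (g x) \<le> k x"
  shows "z t - z s \<le> K"
proof -
  obtain h where h: "\<And>t. t \<ge> 0 \<Longrightarrow> (h has_integral (z t - z 0)) {0..t}"
    and ae: "AE x in lborel. x \<ge> 0 \<longrightarrow>
          (z x > 0 \<longrightarrow> h x = - a * z x - f x) \<and>
          (z x < 0 \<longrightarrow> h x = - a * z x - g x) \<and>
          (z x = 0 \<longrightarrow> - max (f x) (g x) \<le> h x \<and> h x \<le> - min (f x) (g x))"
    using sol unfolding two_zone_sol_def by blast
  obtain N where N: "negligible N" and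
    hN: "\<And>x. x \<notin> N \<Longrightarrow> x \<ge> 0 \<Longrightarrow>
          (z x > 0 \<longrightarrow> h x = - a * z x - f x) \<and>
          (z x < 0 \<longrightarrow> h x = - a * z x - g x) \<and>
          (z x = 0 \<longrightarrow> - max (f x) (g x) \<le> h x \<and> h x \<le> - min (f x) (g x))"
    using AE_completion[OF ae] unfolding eventually_ae_filter_negligible by blast
  \<comment> \<open>The bounds are assumed on the open interval, so the end points join the null
    set.\<close>
  define N' where "N' = N \<union> {s, t}"
  have "negligible N'" unfolding N'_def using N by auto
  then have "((\<lambda>x. if x \<in> N' then k x else h x) has_integral (z t - z s)) {s..t}"
    by (rule has_integral_spike[OF _ _ has_integral_increment[OF h st]]) auto
  then show ?thesis
  proof (rule has_integral_le[OF _ k])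
    fix x assume x: "x \<in> {s..t}"
    show "(if x \<in> N' then k x else h x) \<le> k x"
    proof (cases "x \<in> N'")
      case False
      then have "s < x" "x < t" "x \<notin> N" "x \<ge> 0" using x st unfolding N'_def by auto
      with pos[of x] neg[of x] zero[of x] hN[of x] show ?thesis
        by (cases "z x" "0 :: real" rule: linorder_cases) auto
    qed auto
  qed
qed

text \<open>The velocity agrees almost everywhere with the continuous \<open>k\<close>, so
  \<open>z\<close> is classically differentiable inside the interval and the linearised quantity has
  derivative zero there. Continuity extends this to the ends, where \<open>z\<close> may
  vanish.\<close>

lemma two_zone_positive_flow:
  assumes sol: "two_zone_sol a f g z" and st: "0 \<le> s" "s < t"
    and pos: "\<And>x. s < x \<Longrightarrow> x < t \<Longrightarrow> z x > 0"
    and F: "\<And>x. (F has_real_derivative exp (a * x) * f x) (at x)"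
    and f: "continuous_on UNIV f"
    and x: "s \<le> x" "x \<le> t"
  shows "exp (a * x) * z x + F x = exp (a * s) * z s + F s"
proof -
  define k where "k = (\<lambda>x. - a * z x - f x)"
  have zc: "continuous_on {s..t} z"
    by (rule continuous_on_subset[OF two_zone_continuous[OF sol]]) (use st in auto)
  have kc: "continuous_on {s..t} k"
    unfolding k_def by (intro continuous_intros zc continuous_on_subset[OF f]) auto
  have zk: "z v = z s + integral {s..v} k" if v: "v \<in> {s..t}" for v
  proof -
    have "continuous_on {s..v} k" by (rule continuous_on_subset[OF kc]) (use v in auto)
    then have ki: "(k has_integral integral {s..v} k) {s..v}"
      by (intro integrable_integral integrable_continuous_real)
    have "z v - z s \<le> integral {s..v} k"
      by (rule two_zone_increment_le[OF sol _ _ ki]) (use v st pos in \<open>force simp: k_def\<close>)+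
    \<comment> \<open>The reverse inequality is the same increment bound for the reflected
      solution.\<close>
    moreover have "- z v - - z s \<le> - integral {s..v} k"
      by (rule two_zone_increment_le[OF two_zone_sol_uminus[OF sol] _ _ has_integral_neg[OF ki]])
        (use v st pos in \<open>force simp: k_def\<close>)+
    ultimately show ?thesis by simp
  qed
  have zd: "(z has_real_derivative k v) (at v)" if v: "s < v" "v < t" for v
  proof -
    have "((\<lambda>u. z s + integral {s..u} k) has_real_derivative 0 + k v) (at v within {s..t})"
      by (intro DERIV_add DERIV_const integral_has_real_derivative kc) (use v in auto)
    then have "((\<lambda>u. z s + integral {s..u} k) has_real_derivative k v) (at v)"
      using v by (simp add: at_within_Icc_at)
    then show ?thesis
    proof (rule has_field_derivative_transform_within_open[of _ _ _ "{s<..<t}"])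
      show "z s + integral {s..u} k = z u" if "u \<in> {s<..<t}" for u
        using zk[of u] that by simp
    qed (use v in auto)
  qed
  show ?thesis
  proof (rule DERIV_isconst2[OF \<open>s < t\<close> _ _ x])
    have "continuous_on {s..t} F"
      by (rule DERIV_continuous_on, rule has_field_derivative_at_within, rule F)
    then show "continuous_on {s..t} (\<lambda>x. exp (a * x) * z x + F x)"
      by (intro continuous_intros zc)
    fix v assume v: "s < v" "v < t"
    show "((\<lambda>x. exp (a * x) * z x + F x) has_real_derivative 0) (at v)"
      by (auto intro!: derivative_eq_intros zd[OF v] F simp: k_def algebra_simps)
  qed
qed

text \<open>The set where \<open>z \<le> 0\<close> is compact and has a least point; the
  intermediate value theorem puts a zero no later, hence at that point.\<close>

lemma first_zero:
  fixes z :: "real \<Rightarrow> real"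
  assumes "continuous_on {s..x} z" "z s > 0" "z x \<le> 0" "s \<le> x"
  obtains u where "s < u" "u \<le> x" "z u = 0" "\<And>y. s \<le> y \<Longrightarrow> y < u \<Longrightarrow> z y > 0"
proof -
  define S where "S = {s..x} \<inter> z -` {..0}"
  have "closed S" unfolding S_def
    by (intro continuous_closed_preimage assms) auto
  then have "compact S"
    using compact_Int_closed[of "{s..x}" S] by (simp add: S_def Int_absorb1 Int_assoc[symmetric])
  moreover have "x \<in> S" using assms by (auto simp: S_def)
  ultimately obtain u where u: "u \<in> S" "\<And>y. y \<in> S \<Longrightarrow> u \<le> y"
    using compact_attains_inf[of S] by blast
  have "\<exists>w\<ge>s. w \<le> u \<and> z w = 0"
    using IVT2'[of z u 0 s] assms u continuous_on_subset[OF assms(1), of "{s..u}"]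
    by (auto simp: S_def)
  then obtain w where w: "s \<le> w" "w \<le> u" "z w = 0" by blast
  then have "w = u" using u by (force simp: S_def)
  show ?thesis
  proof (rule that)
    show "s < u" using w \<open>w = u\<close> assms by (cases "s = u") auto
    show "z y > 0" if "s \<le> y" "y < u" for y
      using u that by (force simp: S_def)
  qed (use u w \<open>w = u\<close> in \<open>auto simp: S_def\<close>)
qed

text \<open>At a first zero \<open>u\<close>, conservation would force \<open>F u\<close> to equal
  the conserved value, which \<open>below\<close> excludes.\<close>

lemma two_zone_stays_positive:
  assumes sol: "two_zone_sol a f g z" and "0 \<le> s" "z s > 0"
    and F: "\<And>x. (F has_real_derivative exp (a * x) * f x) (at x)"
    and f: "continuous_on UNIV f"
    and below: "\<And>x. s < x \<Longrightarrow> x < t \<Longrightarrow> F x < exp (a * s) * z s + F s"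
    and x: "s \<le> x" "x < t"
  shows "z x > 0"
proof (rule ccontr)
  assume "\<not> z x > 0"
  then obtain u where u: "s < u" "u \<le> x" "z u = 0" "\<And>y. s \<le> y \<Longrightarrow> y < u \<Longrightarrow> z y > 0"
    using first_zero[of s x z] continuous_on_subset[OF two_zone_continuous[OF sol], of "{s..x}"]
      assms by auto
  have "exp (a * u) * z u + F u = exp (a * s) * z s + F s"
    by (rule two_zone_positive_flow[OF sol \<open>0 \<le> s\<close> \<open>s < u\<close> _ F f]) (use u in auto)
  with below[of u] u x show False by simp
qed

text \<open>Both one-sided fields point downwards, hence so does every admissible velocity on the
  axis. A positive value is impossible because \<open>z\<close> cannot have grown since its last
  zero; a later zero is impossible because \<open>z\<close> would have been positive just before
  it.\<close>

lemma two_zone_leaves_down: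
  assumes sol: "two_zone_sol a f g z" and a: "a \<ge> 0" and p: "0 \<le> p" "z p = 0"
    and f: "continuous_on UNIV f" and g: "continuous_on UNIV g"
    and pos: "\<And>x. p < x \<Longrightarrow> x < r \<Longrightarrow> f x > 0 \<and> g x > 0"
    and x: "p < x" "x < r"
  shows "z x < 0"
proof -
  have le: "z t \<le> 0" if t: "p < t" "t < r" for t
  proof (rule ccontr)
    assume "\<not> z t \<le> 0"
    then have zt: "z t > 0" by simp
    \<comment> \<open>Time reversal makes the last zero before \<open>t\<close> a first
      zero.\<close>
    have "continuous_on {-t..-p} (\<lambda>x. z (- x))"
      using p by (intro continuous_on_compose2[OF two_zone_continuous[OF sol]] continuous_intros) auto
    then obtain u where u: "- t < u" "u \<le> - p" "z (- u) = 0" "\<And>y. - t \<le> y \<Longrightarrow> y < u \<Longrightarrow> z (- y) > 0"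
      using first_zero[of "-t" "-p" "\<lambda>x. z (- x)"] zt p t by auto
    have zp: "z y > 0" if "- u < y" "y < t" for y using u(4)[of "- y"] that by simp
    have "z t - z (- u) \<le> 0"
    proof (rule two_zone_increment_le[OF sol _ _ has_integral_0])
      fix y assume y: "- u < y" "y < t"
      have "a * z y \<ge> 0" "f y > 0" using zp[OF y] a pos[of y] y u t by auto
      then show "- a * z y - f y \<le> 0" by simp
    qed (use zp u p in force)+
    with u zt show False by simp
  qed
  show ?thesis
  proof (rule ccontr)
    assume "\<not> z x < 0"
    with le[OF x] have zx: "z x = 0" by simp
    \<comment> \<open>Near \<open>x\<close> both forcings exceed \<open>m\<close> while the damping
      term stays below \<open>m / 2\<close>, so \<open>z\<close> falls at rate at least
      \<open>m / 2\<close>.\<close>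
    define m where "m = min (f x) (g x) / 2"
    have m: "m > 0" "f x > m" "g x > m" using pos[OF x] by (auto simp: m_def min_def)
    have "continuous_on {0<..} z"
      by (rule continuous_on_subset[OF two_zone_continuous[OF sol]]) auto
    then have c: "isCont z x" "isCont f x" "isCont g x"
      using f g x p
      by (auto simp: continuous_on_eq_continuous_at)
    have "((\<lambda>y. - a * z y) \<longlongrightarrow> - a * z x) (at x)" "(f \<longlongrightarrow> f x) (at x)" "(g \<longlongrightarrow> g x) (at x)"
      using c by (auto intro!: tendsto_intros simp: isCont_def)
    from order_tendstoD(2)[OF this(1), of "m / 2"] order_tendstoD(1)[OF this(2) m(2)]
      order_tendstoD(1)[OF this(3) m(3)]
    have "eventually (\<lambda>y. - a * z y < m / 2 \<and> f y > m \<and> g y > m) (at x)"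
      using m zx by (intro eventually_conj) auto
    then obtain d where d: "d > 0" "\<And>y. y \<noteq> x \<Longrightarrow> dist y x < d \<Longrightarrow> - a * z y < m / 2 \<and> f y > m \<and> g y > m"
      unfolding eventually_at by auto
    define s where "s = max ((p + x) / 2) (x - d / 2)"
    have s: "p < s" "s < x" "x - s < d" using x d(1) by (auto simp: s_def less_max_iff_disj)
    have near: "- a * z y < m / 2 \<and> f y > m \<and> g y > m" if "s < y" "y < x" for y
      using d(2)[of y] that s by (auto simp: dist_real_def)
    have const: "((\<lambda>y. - (m / 2)) has_integral (x - s) * (- (m / 2))) {s..x}"
      using has_integral_const_real[of "- (m / 2)" s x] s by simp
    have "z x - z s \<le> (x - s) * (- (m / 2))"
    proof (rule two_zone_increment_le[OF sol _ _ const])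
      fix y assume y: "s < y" "y < x"
      show "- a * z y - f y \<le> - (m / 2)" "- a * z y - g y \<le> - (m / 2)" using near[OF y] by auto
      show "- min (f y) (g y) \<le> - (m / 2)" using near[OF y] m by auto
    qed (use s p in auto)
    moreover have "(x - s) * (m / 2) > 0" using s m by simp
    ultimately show False using le[of s] s x zx by simp
  qed
qed

text \<open>Transversality forces \<open>z\<close> below the axis right after \<open>p\<close>; from
  then on the barrier \<open>G p < G x\<close> keeps it there up to \<open>q\<close>, which may lie
  beyond the range \<open>r\<close> of transversality.\<close>

lemma two_zone_excursion_down:
  assumes sol: "two_zone_sol a f g z" and a: "a \<ge> 0" and p: "0 \<le> p" "z p = 0" "p < r" "p < q"
    and f: "continuous_on UNIV f" and g: "continuous_on UNIV g"
    and pos: "\<And>x. p < x \<Longrightarrow> x < r \<Longrightarrow> f x > 0 \<and> g x > 0"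
    and G: "\<And>x. (G has_real_derivative exp (a * x) * g x) (at x)"
    and above: "\<And>x. p < x \<Longrightarrow> x < q \<Longrightarrow> G p < G x"
    and x: "p \<le> x" "x \<le> q"
  shows "exp (a * x) * z x + G x = G p"
proof -
  note sol' = two_zone_sol_uminus[OF sol]
  have G': "((\<lambda>x. - G x) has_real_derivative exp (a * x) * (- g x)) (at x)" for x
    using DERIV_minus[OF G] by simp
  have g': "continuous_on UNIV (\<lambda>x. - g x)" by (intro continuous_intros g)
  note down = two_zone_leaves_down[OF sol a p(1,2) f g pos, where r = r]
  define s where "s = (p + min r q) / 2"
  have s: "p < s" "s < r" "s < q" using p by (auto simp: s_def)
  have e: "exp (a * s) * - z s + - G s = exp (a * p) * - z p + - G p"
    by (rule two_zone_positive_flow[OF sol' p(1) s(1) _ G' g']) (use down s in auto)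
  have neg: "z y < 0" if y: "p < y" "y < q" for y
  proof (cases "y < s")
    case True
    then show ?thesis using down[of y] s y by auto
  next
    case False
    have "- z y > 0"
      by (rule two_zone_stays_positive[OF sol' _ _ G' g', where s = s and t = q])
        (use e p s y False down[of s] above in auto)
    then show ?thesis by simp
  qed
  have "exp (a * x) * - z x + - G x = exp (a * p) * - z p + - G p"
    by (rule two_zone_positive_flow[OF sol' p(1,4) _ G' g' x]) (use neg in auto)
  then show ?thesis using p by simp
qed

subsection \<open>Orbits over one period\<close>

text \<open>This is \<open>exp (a * x) * y\<close> for the orbit with crossings \<open>p\<close> and
  \<open>q\<close>. For a crossing pair at most one summand is nonzero at each \<open>x\<close>; the
  clamps give one formula from which continuity in \<open>x\<close> and dependence on
  \<open>p\<close> and \<open>q\<close> can be read off.\<close>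

definition orbit :: "real \<Rightarrow> real \<Rightarrow> real \<Rightarrow> real \<Rightarrow> real" where
  "orbit a p q x = (Hp a p - Hp a (min x p)) + (Hm a p - Hm a (max p (min x q)))
                   + (Hp a q - Hp a (max x q))"

lemma orbit_eq:
  assumes "crossing a p q"
  shows "x \<le> p \<Longrightarrow> orbit a p q x = Hp a p - Hp a x"
    and "p \<le> x \<Longrightarrow> x \<le> q \<Longrightarrow> orbit a p q x = Hm a p - Hm a x"
    and "q \<le> x \<Longrightarrow> orbit a p q x = Hp a q - Hp a x"
  using assms by (auto simp: orbit_def crossing_def min_def max_def)

lemma orbit_sign:
  assumes "crossing a p q"
  shows "0 \<le> x \<Longrightarrow> x < p \<Longrightarrow> orbit a p q x > 0"
    and "p < x \<Longrightarrow> x < q \<Longrightarrow> orbit a p q x < 0"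
    and "q < x \<Longrightarrow> x \<le> 4 \<Longrightarrow> orbit a p q x > 0"
  using assms Hp_less[of x p a] Hm_excursion[OF assms, of x] Hp_greater[of q x a]
  by (auto simp: orbit_eq[OF assms] crossing_def)

lemma orbit_bounds:
  assumes "crossing a p q"
  shows "orbit a p q 0 = Hp a p - Hp a 0" "orbit a p q 4 = Hp a q - Hp a 4"
  using assms by (auto simp: orbit_eq[OF assms] crossing_def)

lemma continuous_orbit: "continuous_on S (orbit a p q)"
  unfolding orbit_def[abs_def]
  by (intro continuous_intros continuous_on_compose2[OF Hp_cont[of UNIV]]
      continuous_on_compose2[OF Hm_cont[of UNIV]]) auto

lemma prim_lipschitz:
  assumes "w > 0" "a > 0" "0 \<le> x" "x \<le> 4" "0 \<le> y" "y \<le> 4"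
  shows "\<bar>prim a w x - prim a w y\<bar> \<le> exp (4 * a) * \<bar>x - y\<bar>"
proof -
  have "norm (prim a w x - prim a w y) \<le> exp (4 * a) * norm (x - y)"
  proof (rule field_differentiable_bound)
    fix s :: real assume s: "s \<in> {0..4}"
    show "(prim a w has_field_derivative exp (a * s) * sin (w * s)) (at s within {0..4})"
      by (rule prim_has_derivative[OF \<open>w > 0\<close>])
    have "exp (a * s) * \<bar>sin (w * s)\<bar> \<le> exp (4 * a) * 1"
      using s assms by (intro mult_mono) auto
    then show "norm (exp (a * s) * sin (w * s)) \<le> exp (4 * a)" by (simp add: abs_mult)
  qed (use assms in auto)
  then show ?thesis by simp
qed

text \<open>Clamping is 1-Lipschitz and the primitives have slope at most \<open>exp (4 * a)\<close>
  on \<open>[0, 4]\<close>; over the six terms each shift occurs at most four times.\<close>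

lemma orbit_dist:
  assumes a: "a > 0" and c: "crossing a p q" "crossing a p' q'" and x: "0 \<le> x" "x \<le> 4"
  shows "\<bar>orbit a p' q' x - orbit a p q x\<bar> \<le> exp (4 * a) * (4 * (\<bar>p' - p\<bar> + \<bar>q' - q\<bar>))"
proof -
  define K where "K = exp (4 * a)"
  have K: "K > 0" by (simp add: K_def)
  have rng: "0 < p" "p < 4" "0 < q" "q < 4" "0 < p'" "p' < 4" "0 < q'" "q' < 4"
    using c by (auto simp: crossing_def)
  have P: "\<bar>Hp a u - Hp a v\<bar> \<le> K * e" and M: "\<bar>Hm a u - Hm a v\<bar> \<le> K * e"
    if "0 \<le> u" "u \<le> 4" "0 \<le> v" "v \<le> 4" "\<bar>u - v\<bar> \<le> e" for u v e
  proof -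
    have e: "exp (4 * a) * \<bar>u - v\<bar> \<le> K * e" using that by (simp add: K_def)
    show "\<bar>Hp a u - Hp a v\<bar> \<le> K * e" "\<bar>Hm a u - Hm a v\<bar> \<le> K * e"
      by (rule order_trans[OF prim_lipschitz e]; use that a in simp)+
  qed
  define A B where "A = \<bar>p' - p\<bar>" and "B = \<bar>q' - q\<bar>"
  have min_lip: "\<bar>min x u - min x v\<bar> \<le> \<bar>u - v\<bar>" and max_lip: "\<bar>max x u - max x v\<bar> \<le> \<bar>u - v\<bar>"
    and max2_lip: "\<bar>max p' u - max p v\<bar> \<le> \<bar>p' - p\<bar> + \<bar>u - v\<bar>" for u v
    by linarith+
  have mm: "\<bar>max p' (min x q') - max p (min x q)\<bar> \<le> A + B"
    using max2_lip[of "min x q'" "min x q"] min_lip[of q' q] unfolding A_def B_def by linarith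
  have "\<bar>Hp a p' - Hp a p\<bar> \<le> K * A" "\<bar>Hm a p' - Hm a p\<bar> \<le> K * A" "\<bar>Hp a q' - Hp a q\<bar> \<le> K * B"
    by (rule P M; use rng in \<open>simp add: A_def B_def\<close>)+
  moreover have "\<bar>Hp a (min x p') - Hp a (min x p)\<bar> \<le> K * A"
    by (rule P) (use rng x min_lip in \<open>auto simp: A_def\<close>)
  moreover have "\<bar>Hp a (max x q') - Hp a (max x q)\<bar> \<le> K * B"
    by (rule P) (use rng x max_lip in \<open>auto simp: B_def\<close>)
  moreover have "\<bar>Hm a (max p' (min x q')) - Hm a (max p (min x q))\<bar> \<le> K * (A + B)"
    by (rule M) (use rng x mm in \<open>auto simp: le_max_iff_disj min_le_iff_disj\<close>)
  ultimately have "\<bar>orbit a p' q' x - orbit a p q x\<bar> \<le> K * A + K * A + K * A + K * (A + B) + K * B + K * B"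
    unfolding orbit_def abs_le_iff by linarith
  also have "\<dots> \<le> K * (4 * (A + B))"
    using K by (simp add: algebra_simps B_def)
  finally show ?thesis by (simp add: K_def A_def B_def)
qed

text \<open>The initial height fixes the first crossing. The solution stays positive up to
  \<open>p\<close>, makes the lower excursion to \<open>q\<close> and then leaves upwards; as both
  crossings are transversal, it cannot branch.\<close>

lemma filippov_on_period:
  assumes a: "a > 0" and sol: "filippov_sol a z" and c: "crossing a p q"
    and z0: "z 0 = Hp a p - Hp a 0" and x: "0 \<le> x" "x \<le> 4"
  shows "exp (a * x) * z x = orbit a p q x"
proof -
  note sol = filippov_sol_two_zone[OF sol]
  note sol' = two_zone_sol_uminus[OF sol]
  have rng: "0 < p" "p < 2/3" "10/3 < q" "q < 4" "Hm a p = Hm a q"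
    using c by (auto simp: crossing_def)
  have cont: "continuous_on UNIV (\<lambda>x. sin (3 * pi * x / 2))" "continuous_on UNIV (\<lambda>x. sin (pi * x / 2))"
    by (intro continuous_intros; simp)+
  have cont': "continuous_on UNIV (\<lambda>x. - sin (3 * pi * x / 2))" "continuous_on UNIV (\<lambda>x. - sin (pi * x / 2))"
    by (intro continuous_intros; simp)+
  have z0pos: "z 0 > 0" using Hp_less[of 0 p a] rng z0 by simp
  have pos: "z y > 0" if "0 \<le> y" "y < p" for y
    by (rule two_zone_stays_positive[OF sol order_refl z0pos Hp_deriv cont(1) _ that])
      (use z0 rng Hp_less in auto)
  have before: "exp (a * y) * z y + Hp a y = Hp a p" if "0 \<le> y" "y \<le> p" for y
    using two_zone_positive_flow[OF sol order_refl rng(1) pos Hp_deriv cont(1) that] z0 by simp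
  have zp: "z p = 0" using before[of p] rng by simp
  have mid: "exp (a * y) * z y + Hm a y = Hm a p" if "p \<le> y" "y \<le> q" for y
    by (rule two_zone_excursion_down[OF sol _ _ zp rng(2) _ cont _ Hm_deriv _ that])
      (use a rng Hm_excursion[OF c] sin_three_half_pos sin_half_pos in auto)
  have zq: "- z q = 0" using mid[of q] rng by simp
  \<comment> \<open>The upward crossing of \<open>z\<close> is a downward crossing of
    \<open>- z\<close>, with the two forcings negated and exchanged.\<close>
  have after: "exp (a * y) * - z y + - Hp a y = - Hp a q" if "q \<le> y" "y \<le> 4" for y
  proof (rule two_zone_excursion_down[OF sol' _ _ zq rng(4) rng(4) cont'(2,1) _ _ _ that])
    show "((\<lambda>x. - Hp a x) has_real_derivative exp (a * x) * - sin (3 * pi * x / 2)) (at x)" for x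
      using DERIV_minus[OF Hp_deriv] by simp
    show "- sin (pi * x / 2) > 0 \<and> - sin (3 * pi * x / 2) > 0" if "q < x" "x < 4" for x
      using sin_three_half_neg[of x] sin_half_neg[of x] that rng by simp
    show "- Hp a q < - Hp a x" if "q < x" "x < 4" for x
      using Hp_greater[of q x a] that rng by simp
  qed (use a rng in auto)
  show ?thesis
    using before[of x] mid[of x] after[of x] x orbit_eq[OF c, of x]
    by (cases "x \<le> p"; cases "x \<le> q") auto
qed

section \<open>Nearby initial heights and translation by periods\<close>

lemma local_inverse:
  fixes f :: "real \<Rightarrow> real"
  assumes cont: "continuous_on UNIV f" and l: "l < p" "p < r"
    and mono: "\<And>x y. l < x \<Longrightarrow> x < y \<Longrightarrow> y < r \<Longrightarrow> f x < f y" and e: "e > 0"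
  shows "\<exists>d>0. \<forall>c. \<bar>c - f p\<bar> < d \<longrightarrow> (\<exists>p'. l < p' \<and> p' < r \<and> \<bar>p' - p\<bar> < e \<and> f p' = c)"
proof -
  define k where "k = min (e / 2) (min ((p - l) / 2) ((r - p) / 2))"
  have k: "k > 0" "k < e" "l < p - k" "p + k < r" using l e by (auto simp: k_def min_def field_simps)
  define d where "d = min (f (p + k) - f p) (f p - f (p - k))"
  have "d > 0" using mono[of p "p + k"] mono[of "p - k" p] k l by (auto simp: d_def)
  moreover have "\<exists>p'. l < p' \<and> p' < r \<and> \<bar>p' - p\<bar> < e \<and> f p' = c" if "\<bar>c - f p\<bar> < d" for c
  proof -
    have "f (p - k) \<le> c" "c \<le> f (p + k)" using that by (auto simp: d_def)
    then obtain p' where "p - k \<le> p'" "p' \<le> p + k" "f p' = c"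
      using IVT'[of f "p - k" c "p + k"] k continuous_on_subset[OF cont] by auto
    then show ?thesis using k by (intro exI[of _ p']) auto
  qed
  ultimately show ?thesis by blast
qed

text \<open>The initial height determines \<open>p'\<close> by inverting \<open>Hp\<close>, and
  \<open>p'\<close> determines \<open>q'\<close> by inverting \<open>Hm\<close>. The latter
  decreases on \<open>(10/3, 4)\<close>, so \<open>- Hm\<close> is inverted there.\<close>

lemma nearby_crossing:
  assumes c: "crossing a p q" and e: "e > 0"
  shows "\<exists>d>0. \<forall>v. \<bar>v - (Hp a p - Hp a 0)\<bar> < d \<longrightarrow>
     (\<exists>p' q'. crossing a p' q' \<and> Hp a p' - Hp a 0 = v \<and> \<bar>p' - p\<bar> < e \<and> \<bar>q' - q\<bar> < e)"
proof -
  have rng: "0 < p" "p < 2/3" "10/3 < q" "q < 4" "Hm a p = Hm a q"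
    using c by (auto simp: crossing_def)
  obtain d1 where d1: "d1 > 0"
    "\<And>v. \<bar>v - - Hm a q\<bar> < d1 \<Longrightarrow> \<exists>q'. 10/3 < q' \<and> q' < 4 \<and> \<bar>q' - q\<bar> < e \<and> - Hm a q' = v"
    using local_inverse[of "\<lambda>x. - Hm a x" "10/3" q 4 e] rng e Hm_greater
    by (auto intro!: continuous_intros Hm_cont)
  have "isCont (Hm a) p" using Hm_deriv DERIV_isCont by blast
  then obtain d2 where d2: "d2 > 0" "\<And>x. \<bar>x - p\<bar> < d2 \<Longrightarrow> \<bar>Hm a x - Hm a p\<bar> < d1"
    using d1(1) unfolding continuous_at_eps_delta by (auto simp: dist_real_def)
  obtain d where d: "d > 0"
    "\<And>v. \<bar>v - Hp a p\<bar> < d \<Longrightarrow> \<exists>p'. 0 < p' \<and> p' < 2/3 \<and> \<bar>p' - p\<bar> < min e d2 \<and> Hp a p' = v"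
    using local_inverse[of "Hp a" 0 p "2/3" "min e d2"] rng e d2 Hp_less Hp_cont by auto
  show ?thesis
  proof (rule exI[of _ d], intro conjI allI impI d(1))
    fix v assume "\<bar>v - (Hp a p - Hp a 0)\<bar> < d"
    then have "\<bar>(v + Hp a 0) - Hp a p\<bar> < d" by (simp add: algebra_simps)
    from d(2)[OF this] obtain p' where p': "0 < p'" "p' < 2/3" "\<bar>p' - p\<bar> < min e d2" "Hp a p' = v + Hp a 0"
      by blast
    have "\<bar>- Hm a p' - - Hm a q\<bar> < d1" using d2(2)[of p'] p' rng by (simp add: abs_minus_commute)
    from d1(2)[OF this] obtain q' where "10/3 < q'" "q' < 4" "\<bar>q' - q\<bar> < e" "Hm a q' = Hm a p'"
      by auto
    then show "\<exists>p' q'. crossing a p' q' \<and> Hp a p' - Hp a 0 = v \<and> \<bar>p' - p\<bar> < e \<and> \<bar>q' - q\<bar> < e"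
      using p' by (intro exI[of _ p'] exI[of _ q']) (auto simp: crossing_def)
  qed
qed

text \<open>The field has period 4 in \<open>x\<close> and translations preserve null sets. This
  reduces long-time behaviour to a single period.\<close>

lemma filippov_sol_shift:
  assumes "filippov_sol a z"
  shows "filippov_sol a (\<lambda>x. z (x + 4 * real n))"
proof -
  define c where "c = 4 * real n"
  have c: "c \<ge> 0" by (simp add: c_def)
  obtain h where h: "\<And>t. t \<ge> 0 \<Longrightarrow> (h has_integral (z t - z 0)) {0..t}"
    and ae: "AE x in lborel. x \<ge> 0 \<longrightarrow> h x \<in> filippov_F a x (z x)"
    using assms unfolding filippov_sol_def by blast
  have cosc: "cos (pi * (x + c)) = cos (pi * x)" and sinc: "sin (pi * (x + c) / 2) = sin (pi * x / 2)" for x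
  proof -
    have "pi * (x + c) = pi * x + 2 * pi * of_int (2 * int n)" "pi * (x + c) / 2 = pi * x / 2 + 2 * pi * of_int (int n)"
      by (auto simp: c_def field_simps)
    then show "cos (pi * (x + c)) = cos (pi * x)" "sin (pi * (x + c) / 2) = sin (pi * x / 2)"
      by (simp_all only: cos_add sin_add sin_int_2pin cos_int_2pin mult_1_right mult_zero_right diff_0_right add_0_right)
  qed
  have F: "filippov_F a (x + c) y = filippov_F a x y" for x y
    unfolding filippov_F_def rhs_def cosc sinc by simp
  obtain N where N: "negligible N" "{x. \<not> (x \<ge> 0 \<longrightarrow> h x \<in> filippov_F a x (z x))} \<subseteq> N"
    using AE_completion[OF ae] unfolding eventually_ae_filter_negligible by blast
  show ?thesis unfolding filippov_sol_def c_def[symmetric]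
  proof (intro exI[of _ "\<lambda>x. h (x + c)"] conjI allI impI)
    fix t :: real assume t: "t \<ge> 0"
    have "(h has_integral (z (c + t) - z c)) {0 + c..t + c}"
      using has_integral_increment[OF h c, of "c + t"] t by (simp add: add.commute)
    then show "((\<lambda>x. h (x + c)) has_integral z (t + c) - z (0 + c)) {0..t}"
      unfolding has_integral_shift_Icc_real[symmetric] by (simp add: o_def add.commute)
  next
    have "AE x in lebesgue. 0 \<le> x \<longrightarrow> h (x + c) \<in> filippov_F a x (z (x + c))"
      unfolding eventually_ae_filter_negligible
    proof (intro exI conjI)
      show "negligible ((+) (- c) ` N)" by (rule negligible_translation[OF N(1)])
      show "{x. \<not> (0 \<le> x \<longrightarrow> h (x + c) \<in> filippov_F a x (z (x + c)))} \<subseteq> (+) (- c) ` N"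
      proof
        fix x assume "x \<in> {x. \<not> (0 \<le> x \<longrightarrow> h (x + c) \<in> filippov_F a x (z (x + c)))}"
        then have "x + c \<in> N" using N(2) c F by auto
        then show "x \<in> (+) (- c) ` N" by (intro image_eqI[of _ _ "x + c"]) auto
      qed
    qed
    then show "AE x in lborel. 0 \<le> x \<longrightarrow> h (x + c) \<in> filippov_F a x (z (x + c))"
      by (simp add: AE_completion_iff)
  qed
qed

subsection \<open>Existence of the fixed point\<close>

lemma cos_300: "cos (5 * pi / 3) = 1 / 2"
proof -
  have "cos (5 * pi / 3) = cos (2 * pi - pi / 3)" by (rule arg_cong[of _ _ cos]) simp
  also have "\<dots> = cos (pi / 3)" by (simp only: cos_diff cos_two_pi sin_two_pi mult_1 mult_zero_left add_0_right)
  finally show ?thesis by (simp add: cos_60)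
qed

text \<open>The upper forcing vanishes at \<open>2/3\<close>, so the gain of \<open>Hp\<close> up to
  that point is of second order in the gain of \<open>Hm\<close>. An implicitly defined crossing can
  thus be replaced by \<open>2/3\<close> at quadratic cost.\<close>

lemma Hp_near_tangency:
  assumes a: "a \<ge> 0" and p: "0 < p" "p < 2/3"
  shows "Hp a (2/3) - Hp a p \<le> 3 * pi * (Hm a (2/3) - Hm a p)\<^sup>2"
proof -
  define v r J where "v = cos (pi * p / 2)" and "r = 1 + 2 * cos (pi * p)" and "J = Hm a (2/3) - Hm a p"
  have J: "J > 0" using Hm_less[of p "2/3" a] p by (simp add: J_def)
  have "Hp a (2/3) - r * Hm a (2/3) \<le> Hp a p - r * Hm a p"
  proof (rule DERIV_nonpos_imp_nonincreasing[of p], use p in simp, intro exI conjI, unfold r_def, rule Hp_minus_Hm_deriv)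
    fix x assume x: "p \<le> x" "x \<le> 2/3"
    have "cos (pi * x) \<le> cos (pi * p)"
      using x p by (intro cos_monotone_0_pi_le) (auto simp: field_simps)
    moreover have "sin (pi * x / 2) > 0" using x p by (intro sin_half_pos) auto
    ultimately show "exp (a * x) * sin (pi * x / 2) * (2 * cos (pi * x) - 2 * cos (pi * p)) \<le> 0"
      by (intro mult_nonneg_nonpos) auto
  qed
  then have 1: "Hp a (2/3) - Hp a p \<le> r * J" by (simp add: J_def algebra_simps)
  \<comment> \<open>Since \<open>exp (a * x) \<ge> 1\<close>, the gain of \<open>Hm\<close> is at
    least the undamped one, which is explicit.\<close>
  have "Hm a p + 2 / pi * cos (pi * p / 2) \<le> Hm a (2/3) + 2 / pi * cos (pi * (2/3) / 2)"
  proof (rule DERIV_nonneg_imp_nondecreasing[of p], use p in simp, intro exI conjI)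
    fix x assume x: "p \<le> x" "x \<le> 2/3"
    show "((\<lambda>x. Hm a x + 2 / pi * cos (pi * x / 2)) has_real_derivative
        exp (a * x) * sin (pi * x / 2) - sin (pi * x / 2)) (at x)"
      by (auto intro!: derivative_eq_intros Hm_deriv)
    have "1 * sin (pi * x / 2) \<le> exp (a * x) * sin (pi * x / 2)"
      using sin_half_pos[of x] a x p by (intro mult_right_mono) auto
    then show "0 \<le> exp (a * x) * sin (pi * x / 2) - sin (pi * x / 2)" by simp
  qed
  then have "pi * (Hm a p + 2 / pi * cos (pi * p / 2)) \<le> pi * (Hm a (2/3) + 2 / pi * cos (pi * (2/3) / 2))"
    by (intro mult_left_mono) auto
  then have 2: "2 * v - 1 \<le> pi * J" by (simp add: J_def v_def cos_60 distrib_left right_diff_distrib)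
  have "cos (pi * p) = 2 * v\<^sup>2 - 1" using cos_double_cos[of "pi * p / 2"] by (simp add: v_def)
  \<comment> \<open>The first factor vanishes at the tangency and is controlled by \<open>J\<close>;
    the second is at most 3, whence the constant \<open>3 * pi\<close>.\<close>
  then have r: "r = (2 * v - 1) * (2 * v + 1)" by (simp add: r_def algebra_simps power2_eq_square)
  have "cos (pi / 3) < v" unfolding v_def
    using p by (intro cos_monotone_0_pi) (auto simp: field_simps)
  then have v: "1 / 2 < v" "v \<le> 1" by (auto simp: cos_60 v_def)
  have "r \<le> (pi * J) * 3" unfolding r using 2 v J by (intro mult_mono) auto
  then have "r * J \<le> (pi * J * 3) * J" using J by (intro mult_right_mono) auto
  with 1 show ?thesis by (simp add: J_def power2_eq_square algebra_simps)
qed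

text \<open>The two sides are the heights at \<open>x = 0\<close> and \<open>x = 4\<close>; the
  exponential undoes the weight in \<open>orbit\<close>.\<close>

definition closing :: "real \<Rightarrow> real \<Rightarrow> real \<Rightarrow> bool" where
  "closing a p q \<longleftrightarrow> Hp a p - Hp a 0 = exp (- 4 * a) * (Hp a q - Hp a 4)"

text \<open>An intermediate value argument in \<open>p\<close>, from 0 to the partner
  \<open>p1\<close> of the return point \<open>10/3\<close>. The assumption \<open>low\<close> keeps
  \<open>p1\<close> positive, and \<open>neg\<close> makes the displacement negative at
  \<open>p1\<close> once \<open>Hp a p1\<close> is compared with \<open>Hp a (2/3)\<close>.\<close>

lemma crossing_closing_exists:
  assumes a: "a > 0" and low: "Hm a 0 < Hm a (10/3)"
    and neg: "exp (- 4 * a) * (Hp a (10/3) - Hp a 4) + 3 * pi * (Hm a (2/3) - Hm a (10/3))\<^sup>2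
              < Hp a (2/3) - Hp a 0"
  shows "\<exists>p q. crossing a p q \<and> closing a p q"
proof -
  have hi: "Hm a (10/3) < Hm a (2/3)" using Hm_reflect_less[of a "2/3"] a by simp
  have m4: "Hm a 4 < Hm a 0" using Hm_reflect_less[of a 0] a by simp
  obtain p1 where p1: "0 \<le> p1" "p1 \<le> 2/3" "Hm a p1 = Hm a (10/3)"
    using IVT'[of "Hm a" 0 "Hm a (10/3)" "2/3"] low hi Hm_cont by auto
  have "p1 \<noteq> 0" "p1 \<noteq> 2/3" using p1(3) low hi by (metis less_irrefl)+
  then have p1': "0 < p1" "p1 < 2/3" using p1 by auto
  \<comment> \<open>\<open>Q\<close> recovers the return point from the common value of
    \<open>Hm\<close> at both crossings.\<close>
  define Q where "Q = the_inv_into {10/3..4} (Hm a)"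
  have inj: "inj_on (Hm a) {10/3..4}"
  proof (rule linorder_inj_onI)
    fix x y :: real assume "x < y" "x \<in> {10/3..4}" "y \<in> {10/3..4}"
    then show "Hm a x \<noteq> Hm a y" using Hm_greater[of x y a] by simp
  qed auto
  have Qc: "continuous_on (Hm a ` {10/3..4}) Q"
    unfolding Q_def by (rule continuous_on_inv[OF Hm_cont]) (auto simp: the_inv_into_f_f[OF inj])
  have img: "Hm a p \<in> Hm a ` {10/3..4}" if p: "p \<in> {0..p1}" for p
  proof -
    have "Hm a 0 \<le> Hm a p" using Hm_less[of 0 p a] p p1 by (cases "p = 0") auto
    moreover have "Hm a p \<le> Hm a p1" using Hm_less[of p p1 a] p p1 by (cases "p = p1") auto
    ultimately obtain q where "10/3 \<le> q" "q \<le> 4" "Hm a q = Hm a p"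
      using IVT2'[of "Hm a" 4 "Hm a p" "10/3"] m4 p1(3) Hm_cont by auto
    then show ?thesis by (intro image_eqI[of _ _ q]) auto
  qed
  have HQ: "Hm a (Q (Hm a p)) = Hm a p" and Qr: "10/3 \<le> Q (Hm a p)" "Q (Hm a p) \<le> 4"
    if "p \<in> {0..p1}" for p
    using f_the_inv_into_f[OF inj img[OF that]] the_inv_into_into[OF inj img[OF that] order_refl]
    by (auto simp: Q_def)
  \<comment> \<open>The height at 4 minus the height at 0.\<close>
  define G where "G = (\<lambda>p. exp (- 4 * a) * (Hp a (Q (Hm a p)) - Hp a 4) - (Hp a p - Hp a 0))"
  have Gc: "continuous_on {0..p1} G"
    unfolding G_def
    by (intro continuous_intros Hp_cont continuous_on_compose2[OF Hp_cont[of UNIV]]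
        continuous_on_compose2[OF Qc Hm_cont]) (use img in auto)
  have Q4: "Q (Hm a p) \<noteq> 4" if "p \<in> {0..p1}" for p
  proof
    assume "Q (Hm a p) = 4"
    then have "Hm a 4 = Hm a p" using HQ[OF that] by simp
    moreover have "Hm a 0 \<le> Hm a p" using Hm_less[of 0 p a] that p1 by (cases "p = 0") auto
    ultimately show False using m4 by simp
  qed
  \<comment> \<open>The initial height is 0 here, while a return before 4 leaves a positive final
    height.\<close>
  have "G 0 > 0" using Hp_greater[of "Q (Hm a 0)" 4 a] Qr[of 0] Q4[of 0] p1 by (simp add: G_def)
  have Q1: "Q (Hm a (10/3)) = 10/3" unfolding Q_def by (rule the_inv_into_f_f[OF inj]) auto
  have "Hp a (2/3) - Hp a p1 \<le> 3 * pi * (Hm a (2/3) - Hm a (10/3))\<^sup>2"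
    using Hp_near_tangency[of a p1] a p1' p1(3) by simp
  then have "G p1 < 0" using neg unfolding G_def p1(3) Q1 by linarith
  obtain p where p: "0 \<le> p" "p \<le> p1" "G p = 0"
    using IVT2'[of G p1 0 0] \<open>G 0 > 0\<close> \<open>G p1 < 0\<close> Gc p1 by auto
  have pp: "p \<noteq> 0" "p \<noteq> p1" using p \<open>G 0 > 0\<close> \<open>G p1 < 0\<close> by auto
  define q where "q = Q (Hm a p)"
  have q: "10/3 \<le> q" "q \<le> 4" "q \<noteq> 4" "Hm a q = Hm a p"
    using Qr[of p] Q4[of p] HQ[of p] p by (auto simp: q_def)
  have "Hm a p < Hm a p1" using Hm_less[of p p1 a] p pp p1 by simp
  then have "q \<noteq> 10/3" using q(4) p1(3) by (metis less_irrefl)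
  then have "crossing a p q" using p pp p1' q by (auto simp: crossing_def)
  moreover have "closing a p q" using p(3) by (simp add: closing_def G_def q_def)
  ultimately show ?thesis by blast
qed

section \<open>The limit of small damping\<close>

lemma prim_differentiable_parameter:
  assumes "w > 0"
  obtains D where "((\<lambda>a. prim a w x) has_real_derivative D) (at a)"
proof -
  have "a\<^sup>2 + w\<^sup>2 \<noteq> 0" using assms by (simp add: sum_power2_eq_zero_iff)
  then have "\<exists>D. ((\<lambda>a. prim a w x) has_real_derivative D) (at a)"
    unfolding prim_def by (intro exI) (auto intro!: derivative_eq_intros)
  with that show ?thesis by blast
qed

text \<open>At \<open>a = 0\<close> the orbit through the tangency point \<open>(2/3, 0)\<close> closes up, so the sign of the
  displacement is decided by its \<open>a\<close>-derivative \<open>- 8 / (9 \<pi>)\<close>.\<close>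
lemma closing_defect_at_tangency:
  "\<exists>d>0. \<forall>a. 0 < a \<and> a < d \<longrightarrow>
     exp (- 4 * a) * (Hp a (10/3) - Hp a 4) + 3 * pi * (Hm a (2/3) - Hm a (10/3))\<^sup>2
       < Hp a (2/3) - Hp a 0"
proof -
  define w where "w = 3 * pi / 2"
  have w: "w > 0" by (simp add: w_def)
  define J where "J = (\<lambda>a. Hm a (2/3) - Hm a (10/3))"
  define \<phi> where "\<phi> = (\<lambda>a. w * (exp (- (2/3) * a) - exp (2/3 * a)) / (a\<^sup>2 + w\<^sup>2) + 3 * pi * (J a)\<^sup>2)"
  obtain D1 D2 where "((\<lambda>a. Hm a (2/3)) has_real_derivative D1) (at 0)"
    "((\<lambda>a. Hm a (10/3)) has_real_derivative D2) (at 0)"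
    using prim_differentiable_parameter[of "pi / 2"] by (metis pi_half_gt_zero)
  then have J': "(J has_real_derivative D1 - D2) (at 0)"
    unfolding J_def by (intro DERIV_diff)
  \<comment> \<open>Because \<open>J\<close> vanishes at 0, its square has no first-order part,
    whatever \<open>D1\<close> and \<open>D2\<close> are.\<close>
  have J0: "J 0 = 0"
    by (simp add: J_def prim_def cos_60 cos_300)
  have "(\<phi> has_real_derivative - (4/3) / w) (at 0)"
    unfolding \<phi>_def using w
    by (auto intro!: derivative_eq_intros J' simp: J0 field_simps power2_eq_square)
  moreover have "- (4/3) / w < 0" using w by simp
  ultimately obtain d where d: "d > 0" "\<And>h. h > 0 \<Longrightarrow> h < d \<Longrightarrow> \<phi> (0 + h) < \<phi> 0"
    using DERIV_neg_dec_right by blast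
  have \<phi>_eq: "exp (- 4 * a) * (Hp a (10/3) - Hp a 4) + 3 * pi * (J a)\<^sup>2 - (Hp a (2/3) - Hp a 0) = \<phi> a" for a
  proof -
    have t: "w * (10/3) = pi + 2 * pi * of_int 2" "w * 4 = 2 * pi * of_int 3" "w * (2/3) = pi"
      by (auto simp: w_def)
    have "prim a w (10/3) = exp (a * (10/3)) * w / (a\<^sup>2 + w\<^sup>2)" "prim a w 4 = - exp (a * 4) * w / (a\<^sup>2 + w\<^sup>2)"
      "prim a w (2/3) = exp (a * (2/3)) * w / (a\<^sup>2 + w\<^sup>2)" "prim a w 0 = - w / (a\<^sup>2 + w\<^sup>2)"
      unfolding prim_def t by (simp_all only: sin_add cos_add sin_int_2pin cos_int_2pin) simp_all
    then have "exp (- 4 * a) * (prim a w (10/3) - prim a w 4) - (prim a w (2/3) - prim a w 0)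
        = ((exp (- 4 * a) * exp (a * (10/3))) * w + (exp (- 4 * a) * exp (a * 4)) * w - exp (2/3 * a) * w - w) / (a\<^sup>2 + w\<^sup>2)"
      by (simp add: algebra_simps add_divide_distrib diff_divide_distrib)
    also have "exp (- 4 * a) * exp (a * (10/3)) = exp (- (2/3) * a)"
      by (simp add: exp_add[symmetric])
    also have "exp (- 4 * a) * exp (a * 4) = 1"
      by (simp add: exp_add[symmetric])
    finally show ?thesis
      unfolding \<phi>_def w_def[symmetric] by (simp add: algebra_simps)
  qed
  have "\<phi> 0 = 0" by (simp add: \<phi>_def J0)
  show ?thesis
  proof (rule exI[of _ d], intro conjI allI impI d(1))
    fix a assume "0 < a \<and> a < d"
    then have "\<phi> a < 0" using d(2)[of a] \<open>\<phi> 0 = 0\<close> by simp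
    then show "exp (- 4 * a) * (Hp a (10/3) - Hp a 4) + 3 * pi * (Hm a (2/3) - Hm a (10/3))\<^sup>2
        < Hp a (2/3) - Hp a 0"
      using \<phi>_eq[of a] by (simp add: J_def)
  qed
qed

text \<open>At \<open>a = 0\<close> the two values are \<open>- 2 / pi\<close> and
  \<open>- 1 / pi\<close>; the strict inequality persists by continuity in \<open>a\<close>.\<close>

lemma Hm_0_less_small:
  "\<exists>d>0. \<forall>a. 0 < a \<and> a < d \<longrightarrow> Hm a 0 < Hm a (10/3)"
proof -
  obtain D1 D2 where "((\<lambda>a. Hm a (10/3)) has_real_derivative D1) (at 0)"
    "((\<lambda>a. Hm a 0) has_real_derivative D2) (at 0)"
    using prim_differentiable_parameter[of "pi / 2"] by (metis pi_half_gt_zero)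
  then have "isCont (\<lambda>a. Hm a (10/3) - Hm a 0) 0"
    by (intro continuous_intros DERIV_isCont)
  moreover have "Hm 0 (10/3) - Hm 0 0 > 0"
    using cos_300 by (simp add: prim_def field_simps)
  ultimately have "eventually (\<lambda>a. Hm a (10/3) - Hm a 0 > 0) (at 0)"
    unfolding isCont_def by (rule order_tendstoD(1))
  then show ?thesis unfolding eventually_at by (auto simp: dist_real_def)
qed

subsection \<open>The periodic orbit and its stability\<close>

definition periodic_orbit :: "real \<Rightarrow> real \<Rightarrow> real \<Rightarrow> real \<Rightarrow> real" where
  "periodic_orbit a p q x =
     exp (- a * (x - 4 * of_int \<lfloor>x / 4\<rfloor>)) * orbit a p q (x - 4 * of_int \<lfloor>x / 4\<rfloor>)"

text \<open>At the right end the floor already belongs to the next block; the closing condition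
  makes both formulas agree, so one formula covers each closed block.\<close>

lemma periodic_orbit_eq:
  assumes c: "crossing a p q" "closing a p q" and x: "4 * real n \<le> x" "x \<le> 4 * real n + 4"
  shows "periodic_orbit a p q x = exp (- a * (x - 4 * real n)) * orbit a p q (x - 4 * real n)"
proof (cases "x = 4 * real n + 4")
  case True
  then have "\<lfloor>x / 4\<rfloor> = int n + 1" by (intro floor_unique) auto
  then have "periodic_orbit a p q x = orbit a p q 0"
    using True by (simp add: periodic_orbit_def)
  also have "\<dots> = exp (- 4 * a) * orbit a p q 4"
    using c(2) by (simp add: orbit_bounds[OF c(1)] closing_def)
  finally show ?thesis using True by (simp add: mult.commute)
next
  case False
  then have "\<lfloor>x / 4\<rfloor> = int n" using x by (intro floor_unique) auto
  then show ?thesis by (simp add: periodic_orbit_def)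
qed

lemma periodic_orbit_0:
  assumes "crossing a p q" "closing a p q"
  shows "periodic_orbit a p q 0 = Hp a p - Hp a 0"
  using periodic_orbit_eq[OF assms, of 0 0] orbit_bounds[OF assms(1)] by simp

lemma periodic4_periodic_orbit: "periodic4 (periodic_orbit a p q)"
proof -
  have "\<lfloor>(x + 4) / 4\<rfloor> = \<lfloor>x / 4\<rfloor> + 1" for x :: real by (simp add: add_divide_distrib)
  then show ?thesis unfolding periodic4_def periodic_orbit_def by (simp add: algebra_simps)
qed

text \<open>Modulo 4 the zeros are \<open>p < 2/3\<close> and \<open>q > 10/3\<close>, whereas the
  sliding set reduces to \<open>(2/3, 4/3)\<close> and \<open>(8/3, 10/3)\<close>.\<close>

lemma periodic_orbit_not_sliding:
  assumes c: "crossing a p q" "closing a p q"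
  shows "\<not> sliding (periodic_orbit a p q)"
proof
  assume "sliding (periodic_orbit a p q)"
  then obtain l r where lr: "0 \<le> l" "l < r"
    "\<And>x. l < x \<Longrightarrow> x < r \<Longrightarrow> periodic_orbit a p q x = 0 \<and> x \<in> sliding_set"
    unfolding sliding_def by auto
  define x where "x = (l + r) / 2"
  have x: "x \<ge> 0" "periodic_orbit a p q x = 0" "x \<in> sliding_set"
    using lr(1,2) lr(3)[of x] by (auto simp: x_def)
  define n where "n = nat \<lfloor>x / 4\<rfloor>"
  have n: "4 * real n \<le> x" "x < 4 * real n + 4"
    using x(1) by (auto simp: n_def) linarith+
  have "orbit a p q (x - 4 * real n) = 0"
    using x(2) periodic_orbit_eq[OF c, of n x] n by simp
  then have pq: "x - 4 * real n = p \<or> x - 4 * real n = q"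
    using orbit_sign[OF c(1), of "x - 4 * real n"] n by (smt (verit))
  obtain m :: nat where m: "2/3 + 2 * real m < x" "x < 4/3 + 2 * real m"
    using x(3) by (auto simp: sliding_set_def)
  \<comment> \<open>The index of the sliding interval relative to the current block; only 0 and 1
    fit into length 4.\<close>
  define i where "i = int m - 2 * int n"
  have i: "2/3 + 2 * real_of_int i < x - 4 * real n" "x - 4 * real n < 4/3 + 2 * real_of_int i"
    using m by (auto simp: i_def)
  have "i < 0 \<or> i = 0 \<or> i = 1 \<or> i \<ge> 2" by linarith
  then show False
  proof (elim disjE)
    assume "i < 0"
    then have "real_of_int i \<le> - 1" by linarith
    then show False using i n by linarith
  next
    assume "i \<ge> 2"
    then have "real_of_int i \<ge> 2" by linarith
    then show False using i n by linarith
  qed (use i n pq c(1) in \<open>auto simp: crossing_def\<close>)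
qed

section \<open>The periodic orbit as a Filippov solution\<close>

lemma filippov_sol_blocks:
  assumes h: "\<And>n u. 4 * real n \<le> u \<Longrightarrow> u \<le> 4 * real n + 4 \<Longrightarrow>
                (h has_integral (y u - y (4 * real n))) {4 * real n..u}"
    and F: "\<And>x. x \<ge> 0 \<Longrightarrow> h x \<in> filippov_F a x (y x)"
  shows "filippov_sol a y"
  unfolding filippov_sol_def
proof (intro exI[of _ h] conjI allI impI)
  have blocks: "(h has_integral (y (4 * real n) - y 0)) {0..4 * real n}" for n
  proof (induction n)
    case 0
    show ?case by (simp add: has_integral_refl)
  next
    case (Suc n)
    have "(h has_integral (y (4 * real n) - y 0 + (y (4 * real (Suc n)) - y (4 * real n)))) {0..4 * real (Suc n)}"
      by (rule has_integral_combine[OF _ _ Suc h]) auto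
    then show ?case by simp
  qed
  fix t :: real assume t: "t \<ge> 0"
  define n where "n = nat \<lfloor>t / 4\<rfloor>"
  have n: "4 * real n \<le> t" "t \<le> 4 * real n + 4"
    using t by (auto simp: n_def) linarith+
  have "(h has_integral (y (4 * real n) - y 0 + (y t - y (4 * real n)))) {0..t}"
    by (rule has_integral_combine[OF _ n(1) blocks h[OF n]]) auto
  then show "(h has_integral (y t - y 0)) {0..t}" by simp
next
  show "AE x in lborel. x \<ge> 0 \<longrightarrow> h x \<in> filippov_F a x (y x)" using F by auto
qed

text \<open>Each branch solves the linear equation of its own zone, and \<open>orbit_sign\<close>
  ensures that \<open>sgn\<close> picks the matching \<open>lam\<close>.\<close>

lemma orbit_velocity:
  assumes c: "crossing a p q" and x: "0 < x" "x < 4" "x \<noteq> p" "x \<noteq> q"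
  defines "Y \<equiv> \<lambda>x. exp (- a * x) * orbit a p q x"
  shows "(Y has_real_derivative rhs a (sgn (Y x)) x (Y x)) (at x)"
proof -
  have rng: "p < q" using c by (auto simp: crossing_def)
  have branch: "(Y has_real_derivative rhs a (sgn (Y x)) x (Y x)) (at x)"
    if S: "open S" "x \<in> S" "\<And>u. u \<in> S \<Longrightarrow> orbit a p q u = K - H u"
      and H: "(H has_real_derivative exp (a * x) * f) (at x)"
      and f: "f = (1 + (1 + sgn (Y x)) * cos (pi * x)) * sin (pi * x / 2)" for S K H f
  proof -
    have "((\<lambda>u. exp (- a * u) * (K - H u)) has_real_derivative
        - a * (exp (- a * x) * (K - H x)) - (exp (- a * x) * exp (a * x)) * f) (at x)"
      by (auto intro!: derivative_eq_intros H simp: algebra_simps)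
    then have "((\<lambda>u. exp (- a * u) * (K - H u)) has_real_derivative
        - a * (exp (- a * x) * (K - H x)) - f) (at x)"
      by (simp add: exp_add[symmetric])
    then have "(Y has_real_derivative - a * (exp (- a * x) * (K - H x)) - f) (at x)"
      by (rule has_field_derivative_transform_within_open[OF _ S(1,2)]) (simp add: Y_def S(3))
    moreover have "Y x = exp (- a * x) * (K - H x)" using S(2,3) by (simp add: Y_def)
    ultimately show ?thesis unfolding rhs_def f by simp
  qed
  have sgnY: "sgn (Y x) = sgn (orbit a p q x)" by (simp add: Y_def sgn_mult)
  consider "x < p" | "p < x" "x < q" | "q < x" using x by linarith
  then show ?thesis
  proof cases
    case 1
    show ?thesis
    proof (rule branch[of "{..<p}", OF _ _ _ Hp_deriv])
      show "sin (3 * pi * x / 2) = (1 + (1 + sgn (Y x)) * cos (pi * x)) * sin (pi * x / 2)"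
        unfolding sin_three sgnY using orbit_sign(1)[OF c, of x] 1 x by simp
    qed (use 1 orbit_eq[OF c] in auto)
  next
    case 2
    show ?thesis
    proof (rule branch[of "{p<..<q}", OF _ _ _ Hm_deriv])
      show "sin (pi * x / 2) = (1 + (1 + sgn (Y x)) * cos (pi * x)) * sin (pi * x / 2)"
        unfolding sgnY using orbit_sign(2)[OF c, of x] 2 by simp
    qed (use 2 orbit_eq[OF c] in auto)
  next
    case 3
    show ?thesis
    proof (rule branch[of "{q<..}", OF _ _ _ Hp_deriv])
      show "sin (3 * pi * x / 2) = (1 + (1 + sgn (Y x)) * cos (pi * x)) * sin (pi * x / 2)"
        unfolding sin_three sgnY using orbit_sign(3)[OF c, of x] 3 x by simp
    qed (use 3 orbit_eq[OF c] in auto)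
  qed
qed

lemma filippov_sol_periodic_orbit:
  assumes c: "crossing a p q" "closing a p q"
  shows "filippov_sol a (periodic_orbit a p q)"
proof (rule filippov_sol_blocks)
  let ?y = "periodic_orbit a p q"
  define Y where "Y = (\<lambda>x. exp (- a * x) * orbit a p q x)"
  \<comment> \<open>On the axis \<open>sgn\<close> selects \<open>lam = 0\<close>, which is
    admissible, so the inclusion holds at every \<open>x\<close>.\<close>
  define h where "h = (\<lambda>x. rhs a (sgn (?y x)) x (?y x))"
  fix n :: nat and u :: real assume u: "4 * real n \<le> u" "u \<le> 4 * real n + 4"
  have yY: "?y x = Y (x - 4 * real n)" if "4 * real n \<le> x" "x \<le> 4 * real n + 4" for x
    using periodic_orbit_eq[OF c that] by (simp add: Y_def)
  have per: "rhs a l (x - 4 * real n) v = rhs a l x v" for l x v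
  proof -
    have e: "pi * (x - 4 * real n) = pi * x - 2 * pi * of_int (2 * int n)"
      "pi * (x - 4 * real n) / 2 = pi * x / 2 - 2 * pi * of_int (int n)"
      by (auto simp: field_simps)
    have "cos (pi * (x - 4 * real n)) = cos (pi * x)"
      unfolding e(1) by (simp only: cos_diff sin_int_2pin cos_int_2pin mult_1_right mult_zero_right add_0_right)
    moreover have "sin (pi * (x - 4 * real n) / 2) = sin (pi * x / 2)"
      unfolding e(2) by (simp only: sin_diff sin_int_2pin cos_int_2pin mult_1_right mult_zero_right diff_0_right)
    ultimately show ?thesis by (simp add: rhs_def)
  qed
  show "(h has_integral (?y u - ?y (4 * real n))) {4 * real n..u}"
  \<comment> \<open>The velocity may jump at the two crossings, where continuity suffices.\<close>
  proof (rule fundamental_theorem_of_calculus_interior_strong[of "{4 * real n + p, 4 * real n + q}"])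
    have "continuous_on {4 * real n..u} (\<lambda>x. Y (x - 4 * real n))"
      unfolding Y_def by (intro continuous_intros continuous_on_compose2[OF continuous_orbit[of UNIV]]) auto
    then show "continuous_on {4 * real n..u} ?y"
      by (rule continuous_on_eq) (use u yY in auto)
    fix x assume x: "x \<in> {4 * real n<..<u} - {4 * real n + p, 4 * real n + q}"
    have "(Y has_real_derivative rhs a (sgn (Y (x - 4 * real n))) (x - 4 * real n) (Y (x - 4 * real n)))
        (at (x - 4 * real n))"
      unfolding Y_def by (rule orbit_velocity[OF c(1)]) (use x u in auto)
    moreover have "h x = rhs a (sgn (Y (x - 4 * real n))) (x - 4 * real n) (Y (x - 4 * real n))"
      unfolding per h_def using yY[of x] x u by simp
    ultimately have "(Y has_real_derivative h x) (at (x - 4 * real n))" by simp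
    then have "((\<lambda>x. Y (x - 4 * real n)) has_real_derivative h x) (at x)"
      using DERIV_shift[of Y "h x" x "- (4 * real n)"] by simp
    then have "(?y has_real_derivative h x) (at x)"
      by (rule has_field_derivative_transform_within_open[of _ _ _ "{4 * real n<..<4 * real n + 4}"])
        (use x u yY in auto)
    then show "(?y has_vector_derivative h x) (at x)"
      by (simp add: has_real_derivative_iff_has_vector_derivative)
  qed (use u in auto)
next
  fix x :: real
  show "rhs a (sgn (periodic_orbit a p q x)) x (periodic_orbit a p q x)
      \<in> filippov_F a x (periodic_orbit a p q x)"
    by (auto simp: filippov_F_def sgn_if intro!: exI[of _ 0])
qed

text \<open>Contraction gives geometric decay at multiples of 4, and periodicity carries the
  closeness over one period to every later block. Since \<open>\<kappa> ^ n \<le> 1\<close>, each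
  shifted solution stays within \<open>\<delta>\<close>, so the one-period estimate can be
  iterated.\<close>

lemma stable_of_period_contraction:
  fixes \<kappa> :: real
  assumes per: "periodic4 y" and \<kappa>: "0 \<le> \<kappa>" "\<kappa> < 1"
    and step: "\<And>\<epsilon>. \<epsilon> > 0 \<Longrightarrow> \<exists>\<delta>>0. \<forall>z. filippov_sol a z \<and> \<bar>z 0 - y 0\<bar> < \<delta> \<longrightarrow>
        (\<forall>x. 0 \<le> x \<and> x \<le> 4 \<longrightarrow> \<bar>z x - y x\<bar> < \<epsilon>) \<and> \<bar>z 4 - y 4\<bar> \<le> \<kappa> * \<bar>z 0 - y 0\<bar>"
  shows "loc_asym_stable a y"
proof -
  have yper: "y (x + 4 * real n) = y x" if "x \<ge> 0" for x n
  proof (induction n)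
    case (Suc n)
    have "y ((x + 4 * real n) + 4) = y (x + 4 * real n)"
      using per that unfolding periodic4_def by simp
    with Suc show ?case by (simp add: algebra_simps)
  qed simp
  have decay: "\<bar>z (4 * real n) - y 0\<bar> \<le> \<kappa> ^ n * \<bar>z 0 - y 0\<bar>"
    if \<delta>: "\<And>z. filippov_sol a z \<Longrightarrow> \<bar>z 0 - y 0\<bar> < \<delta> \<Longrightarrow> \<bar>z 4 - y 4\<bar> \<le> \<kappa> * \<bar>z 0 - y 0\<bar>"
      and z: "filippov_sol a z" "\<bar>z 0 - y 0\<bar> < \<delta>" for z \<delta> n
  proof (induction n)
    case (Suc n)
    have "\<kappa> ^ n * \<bar>z 0 - y 0\<bar> \<le> 1 * \<bar>z 0 - y 0\<bar>"
      using \<kappa> by (intro mult_right_mono power_le_one) auto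
    then have "\<bar>z (0 + 4 * real n) - y 0\<bar> < \<delta>" using Suc z(2) by simp
    from \<delta>[OF filippov_sol_shift[OF z(1)] this]
    have "\<bar>z (4 * real (Suc n)) - y 0\<bar> \<le> \<kappa> * \<bar>z (4 * real n) - y 0\<bar>"
      using yper[of 0 1] by (simp add: algebra_simps)
    also have "\<dots> \<le> \<kappa> * (\<kappa> ^ n * \<bar>z 0 - y 0\<bar>)" by (intro mult_left_mono Suc \<kappa>)
    finally show ?case by simp
  qed simp
  have near: "\<bar>z x - y x\<bar> < \<epsilon>"
    if \<delta>: "\<And>z x. filippov_sol a z \<Longrightarrow> \<bar>z 0 - y 0\<bar> < \<delta> \<Longrightarrow> 0 \<le> x \<Longrightarrow> x \<le> 4 \<Longrightarrow> \<bar>z x - y x\<bar> < \<epsilon>"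
      and z: "filippov_sol a z" and d: "\<And>n. n \<ge> N \<Longrightarrow> \<bar>z (4 * real n) - y 0\<bar> < \<delta>"
      and x: "x \<ge> 4 * real N" for z x \<delta> \<epsilon> N
  proof -
    define n where "n = nat \<lfloor>x / 4\<rfloor>"
    have n: "4 * real n \<le> x" "x \<le> 4 * real n + 4" "N \<le> n"
      using x by (auto simp: n_def le_nat_floor) linarith+
    have "\<bar>z (x - 4 * real n + 4 * real n) - y (x - 4 * real n)\<bar> < \<epsilon>"
      by (rule \<delta>[OF filippov_sol_shift[OF z]]) (use n d in auto)
    then show ?thesis using yper[of "x - 4 * real n" n] n by simp
  qed
  show ?thesis unfolding loc_asym_stable_def
  proof (intro conjI allI impI)
    fix \<epsilon> :: real assume "\<epsilon> > 0"
    from step[OF this] obtain \<delta> where \<delta>: "\<delta> > 0"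
      "\<And>z x. filippov_sol a z \<Longrightarrow> \<bar>z 0 - y 0\<bar> < \<delta> \<Longrightarrow> 0 \<le> x \<Longrightarrow> x \<le> 4 \<Longrightarrow> \<bar>z x - y x\<bar> < \<epsilon>"
      "\<And>z. filippov_sol a z \<Longrightarrow> \<bar>z 0 - y 0\<bar> < \<delta> \<Longrightarrow> \<bar>z 4 - y 4\<bar> \<le> \<kappa> * \<bar>z 0 - y 0\<bar>" by blast
    have "\<bar>z x - y x\<bar> < \<epsilon>" if z: "filippov_sol a z" "\<bar>z 0 - y 0\<bar> < \<delta>" and x: "x \<ge> 0" for z x
    proof (rule near[where \<delta> = \<delta> and \<epsilon> = \<epsilon> and z = z and N = 0])
      show "filippov_sol a z" by (rule z(1))
      show "\<bar>z x - y x\<bar> < \<epsilon>" if "filippov_sol a z" "\<bar>z 0 - y 0\<bar> < \<delta>" "0 \<le> x" "x \<le> 4" for z x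
        using \<delta>(2) that by blast
      show "\<bar>z (4 * real n) - y 0\<bar> < \<delta>" for n
      proof -
        have "\<kappa> ^ n * \<bar>z 0 - y 0\<bar> \<le> 1 * \<bar>z 0 - y 0\<bar>"
          using \<kappa> by (intro mult_right_mono power_le_one) auto
        with decay[OF \<delta>(3) z, of n] z(2) show ?thesis by simp
      qed
    qed (use x in auto)
    with \<delta>(1) show "\<exists>\<delta>>0. \<forall>z. filippov_sol a z \<and> \<bar>z 0 - y 0\<bar> < \<delta> \<longrightarrow> (\<forall>x\<ge>0. \<bar>z x - y x\<bar> < \<epsilon>)"
      by blast
  next
    from step[of 1] obtain \<delta> where \<delta>: "\<delta> > 0"
      "\<And>z. filippov_sol a z \<Longrightarrow> \<bar>z 0 - y 0\<bar> < \<delta> \<Longrightarrow> \<bar>z 4 - y 4\<bar> \<le> \<kappa> * \<bar>z 0 - y 0\<bar>" by auto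
    have "((\<lambda>x. z x - y x) \<longlongrightarrow> 0) at_top" if z: "filippov_sol a z" "\<bar>z 0 - y 0\<bar> < \<delta>" for z
    proof (rule tendstoI)
      fix \<epsilon> :: real assume "\<epsilon> > 0"
      \<comment> \<open>Two radii are in play: \<open>\<delta>\<close> keeps the contraction
        running, while \<open>\<eta>\<close>, reached after finitely many periods, yields closeness
        \<open>\<epsilon>\<close>.\<close>
      from step[OF this] obtain \<eta> where \<eta>: "\<eta> > 0"
        "\<And>z x. filippov_sol a z \<Longrightarrow> \<bar>z 0 - y 0\<bar> < \<eta> \<Longrightarrow> 0 \<le> x \<Longrightarrow> x \<le> 4 \<Longrightarrow> \<bar>z x - y x\<bar> < \<epsilon>" by blast
      have "(\<lambda>n. \<kappa> ^ n * \<bar>z 0 - y 0\<bar>) \<longlonglongrightarrow> 0 * \<bar>z 0 - y 0\<bar>"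
        using \<kappa> by (intro tendsto_mult tendsto_const LIMSEQ_power_zero) auto
      then have "eventually (\<lambda>n. \<kappa> ^ n * \<bar>z 0 - y 0\<bar> < \<eta>) sequentially"
        using \<eta>(1) by (intro order_tendstoD(2)) auto
      then obtain N where N: "\<And>n. n \<ge> N \<Longrightarrow> \<kappa> ^ n * \<bar>z 0 - y 0\<bar> < \<eta>"
        unfolding eventually_sequentially by blast
      have "\<bar>z x - y x\<bar> < \<epsilon>" if "x \<ge> 4 * real N" for x
      proof (rule near[where \<delta> = \<eta> and \<epsilon> = \<epsilon> and z = z and N = N])
        show "filippov_sol a z" by (rule z(1))
        show "\<bar>z x - y x\<bar> < \<epsilon>" if "filippov_sol a z" "\<bar>z 0 - y 0\<bar> < \<eta>" "0 \<le> x" "x \<le> 4" for z x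
          using \<eta>(2) that by blast
        show "\<bar>z (4 * real n) - y 0\<bar> < \<eta>" if "n \<ge> N" for n
          using decay[OF \<delta>(2) z, of n] N[OF that] by simp
      qed (rule that)
      then show "eventually (\<lambda>x. dist (z x - y x) 0 < \<epsilon>) at_top"
        unfolding eventually_at_top_linorder by (intro exI[of _ "4 * real N"]) auto
    qed
    with \<delta>(1) show "\<exists>\<delta>>0. \<forall>z. filippov_sol a z \<and> \<bar>z 0 - y 0\<bar> < \<delta> \<longrightarrow> ((\<lambda>x. z x - y x) \<longlongrightarrow> 0) at_top"
      by blast
  qed
qed

text \<open>Nearby solutions have crossing pairs of their own, and between such pairs the increments
  of \<open>Hp\<close> do not expand; undoing the weight over one period supplies the factor
  \<open>exp (- 4 * a)\<close>.\<close>

lemma periodic_orbit_stable: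
  assumes a: "a > 0" and c: "crossing a p q" "closing a p q"
  shows "loc_asym_stable a (periodic_orbit a p q)"
proof (rule stable_of_period_contraction[where \<kappa> = "exp (- 4 * a)"])
  let ?y = "periodic_orbit a p q"
  fix \<epsilon> :: real assume \<epsilon>: "\<epsilon> > 0"
  have rng: "0 < p" "p < 2/3" "10/3 < q" "q < 4" "Hm a p = Hm a q"
    using c by (auto simp: crossing_def)
  have "q < 4 - p" using return_early[of a p q] rng a by simp
  \<comment> \<open>The first bound secures \<open>p' \<le> 4 - q\<close> and
    \<open>p \<le> 4 - q'\<close> for the return map estimate; the second absorbs the constant of
    \<open>orbit_dist\<close>.\<close>
  define e where "e = min ((4 - p - q) / 2) (\<epsilon> / (exp (4 * a) * 8))"
  have e: "e > 0" using \<epsilon> \<open>q < 4 - p\<close> by (simp add: e_def)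
  obtain d where d: "d > 0" "\<And>v. \<bar>v - (Hp a p - Hp a 0)\<bar> < d \<Longrightarrow>
     \<exists>p' q'. crossing a p' q' \<and> Hp a p' - Hp a 0 = v \<and> \<bar>p' - p\<bar> < e \<and> \<bar>q' - q\<bar> < e"
    using nearby_crossing[OF c(1) e] by blast
  have "(\<forall>x. 0 \<le> x \<and> x \<le> 4 \<longrightarrow> \<bar>z x - ?y x\<bar> < \<epsilon>) \<and> \<bar>z 4 - ?y 4\<bar> \<le> exp (- 4 * a) * \<bar>z 0 - ?y 0\<bar>"
    if z: "filippov_sol a z" "\<bar>z 0 - ?y 0\<bar> < d" for z
  proof -
    obtain p' q' where pq: "crossing a p' q'" "Hp a p' - Hp a 0 = z 0" "\<bar>p' - p\<bar> < e" "\<bar>q' - q\<bar> < e"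
      using d(2)[of "z 0"] z(2) periodic_orbit_0[OF c] by auto
    have zx: "z x = exp (- a * x) * orbit a p' q' x" and yx: "?y x = exp (- a * x) * orbit a p q x"
      if "0 \<le> x" "x \<le> 4" for x
      using filippov_on_period[OF a z(1) pq(1) pq(2)[symmetric] that] periodic_orbit_eq[OF c, of 0 x] that
      by (auto simp: exp_minus field_simps)
    have "\<bar>z x - ?y x\<bar> < \<epsilon>" if x: "0 \<le> x" "x \<le> 4" for x
    proof -
      have "\<bar>z x - ?y x\<bar> = exp (- a * x) * \<bar>orbit a p' q' x - orbit a p q x\<bar>"
        unfolding zx[OF x] yx[OF x] by (simp add: right_diff_distrib[symmetric] abs_mult)
      also have "\<dots> \<le> 1 * \<bar>orbit a p' q' x - orbit a p q x\<bar>"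
        using a x by (intro mult_right_mono) auto
      also have "\<dots> \<le> exp (4 * a) * (4 * (\<bar>p' - p\<bar> + \<bar>q' - q\<bar>))"
        using orbit_dist[OF a c(1) pq(1) x] by simp
      also have "\<dots> < exp (4 * a) * (4 * (e + e))"
        using pq by (intro mult_strict_left_mono add_strict_mono) auto
      also have "\<dots> = e * (exp (4 * a) * 8)" by simp
      also have "\<dots> \<le> \<epsilon> / (exp (4 * a) * 8) * (exp (4 * a) * 8)"
        by (intro mult_right_mono) (auto simp: e_def)
      finally show ?thesis by simp
    qed
    moreover have "\<bar>z 4 - ?y 4\<bar> \<le> exp (- 4 * a) * \<bar>z 0 - ?y 0\<bar>"
    proof -
      have e2: "e \<le> (4 - p - q) / 2" unfolding e_def by (rule min.cobounded1)
      have "\<bar>Hp a q' - Hp a q\<bar> \<le> \<bar>Hp a p' - Hp a p\<bar>"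
      \<comment> \<open>The estimate requires ordered downward crossings, so the two orbits exchange
        roles in the second case.\<close>
      proof (cases "p \<le> p'")
        case True
        have "p' \<le> 4 - q" using pq(3) e2 \<open>q < 4 - p\<close> by (simp add: abs_less_iff field_simps)
        from return_map_nonexpanding[OF c(1) pq(1) True this] show ?thesis by linarith
      next
        case False
        then have "p' \<le> p" by simp
        have "p \<le> 4 - q'" using pq(4) e2 \<open>q < 4 - p\<close> by (simp add: abs_less_iff field_simps)
        from return_map_nonexpanding[OF pq(1) c(1) \<open>p' \<le> p\<close> this] show ?thesis by linarith
      qed
      then have "exp (- 4 * a) * \<bar>Hp a q' - Hp a q\<bar> \<le> exp (- 4 * a) * \<bar>Hp a p' - Hp a p\<bar>"
        by simp
      moreover have "z 4 - ?y 4 = exp (- 4 * a) * (Hp a q' - Hp a q)"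
        using zx[of 4] yx[of 4] orbit_bounds(2)[OF c(1)] orbit_bounds(2)[OF pq(1)]
        by (simp add: algebra_simps)
      moreover have "z 0 - ?y 0 = Hp a p' - Hp a p"
        using pq(2) periodic_orbit_0[OF c] by simp
      ultimately show ?thesis by (simp add: abs_mult)
    qed
    ultimately show ?thesis by blast
  qed
  with d(1) show "\<exists>\<delta>>0. \<forall>z. filippov_sol a z \<and> \<bar>z 0 - ?y 0\<bar> < \<delta> \<longrightarrow>
        (\<forall>x. 0 \<le> x \<and> x \<le> 4 \<longrightarrow> \<bar>z x - ?y x\<bar> < \<epsilon>) \<and> \<bar>z 4 - ?y 4\<bar> \<le> exp (- 4 * a) * \<bar>z 0 - ?y 0\<bar>"
    by blast
qed (use a periodic4_periodic_orbit in auto)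

theorem theorem1:
  shows "\<exists>a_l>0. \<forall>a. 0 < a \<and> a < a_l \<longrightarrow>
           (\<exists>y. filippov_sol a y \<and> \<not> sliding y \<and> periodic4 y \<and> loc_asym_stable a y)"
proof -
  obtain d1 where d1: "d1 > 0" "\<And>a. 0 < a \<Longrightarrow> a < d1 \<Longrightarrow> Hm a 0 < Hm a (10/3)"
    using Hm_0_less_small by blast
  obtain d2 where d2: "d2 > 0" "\<And>a. 0 < a \<Longrightarrow> a < d2 \<Longrightarrow>
     exp (- 4 * a) * (Hp a (10/3) - Hp a 4) + 3 * pi * (Hm a (2/3) - Hm a (10/3))\<^sup>2
       < Hp a (2/3) - Hp a 0"
    using closing_defect_at_tangency by blast
  have "\<exists>y. filippov_sol a y \<and> \<not> sliding y \<and> periodic4 y \<and> loc_asym_stable a y"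
    if a: "0 < a" "a < min d1 d2" for a
  proof -
    \<comment> \<open>Smallness of \<open>a\<close> enters here, in locating a closing pair; the
      properties of the orbit then hold for every \<open>a > 0\<close> with such a pair.\<close>
    obtain p q where "crossing a p q" "closing a p q"
      using crossing_closing_exists[OF a(1) d1(2) d2(2)] a by auto
    then show ?thesis
      using filippov_sol_periodic_orbit periodic_orbit_not_sliding periodic4_periodic_orbit
        periodic_orbit_stable[OF a(1)] by blast
  qed
  with d1(1) d2(1) show ?thesis by (intro exI[of _ "min d1 d2"]) auto
qed

end
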